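(* Let $S=\prod_{i=1}^k S_i$ be a unital semisimple ring with $S_i=Se_i=M_{q_i}(R_i)$ for division rings $R_i$, central idempotents $e_i$ and integers $q_i\geq1$. Let $M$ be a right $S$-module with $M_i:=Me_i$ infinite for each $i$. Then $\overline{\mathcal X}^*(M_S)\cong\prod_{i=1}^k q_i\mathbb N\cong\mathbb N^k$ as monoids.
   Context: A right $S$-module $M$ is a structure in the language $L_S=\langle +,-,0,\{\cdot_s:s\in S\}\rangle$ ($\cdot_s$ = right multiplication by $s$). A positive primitive (pp) formula is one of the form $\exists \bar y\,\bigwedge_j(\text{linear equation in }\bar x,\bar y)$; a subset of some $M^n$ is pp-definable if it is defined by a pp-formula with parameters from $M$, and a pp-definable bijection is a bijection whose graph is pp-definable. $\overline{\mathcal X}^*(M_S)$ is the set of equivalence classes of non-empty pp-definable subsets of finite powers of $M$ under "there is a pp-definable bijection between them", a commutative monoid under the operation induced by Cartesian product. $q\mathbb N=\{0,q,2q,\dots\}$ and $\mathbb N^k$ are additive monoids. *)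

theory Defs
  imports "HOL-Algebra.Algebra"
begin

text \<open>Division rings, not necessarily commutative.\<close>

locale skew_field = ring R for R (structure) +
  assumes one_not_zero: "\<one> \<noteq> \<zero>"
    and units: "Units R = carrier R - {\<zero>}"

definition matrix_ring :: "nat \<Rightarrow> ('r, 'c) ring_scheme \<Rightarrow> (nat \<times> nat \<Rightarrow> 'r) ring" where
  "matrix_ring q R =
    \<lparr>carrier = ({..<q} \<times> {..<q}) \<rightarrow>\<^sub>E carrier R,
     monoid.mult = (\<lambda>A B. \<lambda>(i, j)\<in>{..<q} \<times> {..<q}. \<Oplus>\<^bsub>R\<^esub>l\<in>{..<q}. A (i, l) \<otimes>\<^bsub>R\<^esub> B (l, j)),
     monoid.one = (\<lambda>(i, j)\<in>{..<q} \<times> {..<q}. if i = j then \<one>\<^bsub>R\<^esub> else \<zero>\<^bsub>R\<^esub>),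
     ring.zero = (\<lambda>p\<in>{..<q} \<times> {..<q}. \<zero>\<^bsub>R\<^esub>),
     ring.add = (\<lambda>A B. \<lambda>p\<in>{..<q} \<times> {..<q}. A p \<oplus>\<^bsub>R\<^esub> B p)\<rparr>"

definition product_ring :: "'i set \<Rightarrow> ('i \<Rightarrow> ('s, 'c) ring_scheme) \<Rightarrow> ('i \<Rightarrow> 's) ring" where
  "product_ring I T =
    \<lparr>carrier = (\<Pi>\<^sub>E i\<in>I. carrier (T i)),
     monoid.mult = (\<lambda>x y. \<lambda>i\<in>I. x i \<otimes>\<^bsub>T i\<^esub> y i),
     one = (\<lambda>i\<in>I. \<one>\<^bsub>T i\<^esub>),
     ring.zero = (\<lambda>i\<in>I. \<zero>\<^bsub>T i\<^esub>),
     ring.add = (\<lambda>x y. \<lambda>i\<in>I. x i \<oplus>\<^bsub>T i\<^esub> y i)\<rparr>"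

definition central_idempotent :: "('s, 'c) ring_scheme \<Rightarrow> 's \<Rightarrow> bool" where
  "central_idempotent S e \<longleftrightarrow>
    e \<in> carrier S \<and> e \<otimes>\<^bsub>S\<^esub> e = e \<and> (\<forall>s\<in>carrier S. s \<otimes>\<^bsub>S\<^esub> e = e \<otimes>\<^bsub>S\<^esub> s)"

text \<open>The ring \<open>Se\<close>, whose identity element is \<open>e\<close>.\<close>

definition ideal_ring :: "('s, 'c) ring_scheme \<Rightarrow> 's \<Rightarrow> ('s, 'c) ring_scheme" where
  "ideal_ring S e = S\<lparr>carrier := (\<lambda>s. s \<otimes>\<^bsub>S\<^esub> e) ` carrier S, one := e\<rparr>"

text \<open>The scalar operation \<open>s \<odot>\<^bsub>M\<^esub> x\<close> of the record \<open>module\<close> is read as right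
  multiplication \<open>x \<cdot> s\<close>; this is what the order of factors in \<open>act_mult\<close> expresses.\<close>

locale right_module = S?: ring S + M?: abelian_group M
  for S :: "('s, 'c) ring_scheme" (structure) and M :: "('s, 'm, 'd) module_scheme" (structure) +
  assumes act_closed: "\<lbrakk>s \<in> carrier S; x \<in> carrier M\<rbrakk> \<Longrightarrow> s \<odot>\<^bsub>M\<^esub> x \<in> carrier M"
    and act_add: "\<lbrakk>s \<in> carrier S; x \<in> carrier M; y \<in> carrier M\<rbrakk>
      \<Longrightarrow> s \<odot>\<^bsub>M\<^esub> (x \<oplus>\<^bsub>M\<^esub> y) = (s \<odot>\<^bsub>M\<^esub> x) \<oplus>\<^bsub>M\<^esub> (s \<odot>\<^bsub>M\<^esub> y)"
    and add_act: "\<lbrakk>s \<in> carrier S; t \<in> carrier S; x \<in> carrier M\<rbrakk>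
      \<Longrightarrow> (s \<oplus>\<^bsub>S\<^esub> t) \<odot>\<^bsub>M\<^esub> x = (s \<odot>\<^bsub>M\<^esub> x) \<oplus>\<^bsub>M\<^esub> (t \<odot>\<^bsub>M\<^esub> x)"
    and act_mult: "\<lbrakk>s \<in> carrier S; t \<in> carrier S; x \<in> carrier M\<rbrakk>
      \<Longrightarrow> (s \<otimes>\<^bsub>S\<^esub> t) \<odot>\<^bsub>M\<^esub> x = t \<odot>\<^bsub>M\<^esub> (s \<odot>\<^bsub>M\<^esub> x)"
    and act_one: "x \<in> carrier M \<Longrightarrow> \<one>\<^bsub>S\<^esub> \<odot>\<^bsub>M\<^esub> x = x"

datatype 's lterm =
    LVar nat
  | LZero
  | LPlus "'s lterm" "'s lterm"
  | LMinus "'s lterm"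
  | LMult "'s lterm" 's

primrec lterm_scalars :: "'s lterm \<Rightarrow> 's set" where
  "lterm_scalars (LVar i) = {}"
| "lterm_scalars LZero = {}"
| "lterm_scalars (LPlus t u) = lterm_scalars t \<union> lterm_scalars u"
| "lterm_scalars (LMinus t) = lterm_scalars t"
| "lterm_scalars (LMult t s) = insert s (lterm_scalars t)"

primrec lterm_vars :: "'s lterm \<Rightarrow> nat set" where
  "lterm_vars (LVar i) = {i}"
| "lterm_vars LZero = {}"
| "lterm_vars (LPlus t u) = lterm_vars t \<union> lterm_vars u"
| "lterm_vars (LMinus t) = lterm_vars t"
| "lterm_vars (LMult t s) = lterm_vars t"

primrec lterm_eval :: "('s, 'm, 'c) module_scheme \<Rightarrow> 'm list \<Rightarrow> 's lterm \<Rightarrow> 'm" where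
  "lterm_eval M v (LVar i) = v ! i"
| "lterm_eval M v LZero = \<zero>\<^bsub>M\<^esub>"
| "lterm_eval M v (LPlus t u) = lterm_eval M v t \<oplus>\<^bsub>M\<^esub> lterm_eval M v u"
| "lterm_eval M v (LMinus t) = \<ominus>\<^bsub>M\<^esub> lterm_eval M v t"
| "lterm_eval M v (LMult t s) = s \<odot>\<^bsub>M\<^esub> lterm_eval M v t"

text \<open>\<open>PP l E\<close>, as a formula in \<open>n\<close> free variables, has free variables
  \<open>LVar 0, \<dots>, LVar (n - 1)\<close>; it existentially quantifies the next \<open>l\<close> variables
  \<open>LVar n, \<dots>, LVar (n + l - 1)\<close> over the conjunction of the equations in \<open>E\<close>.\<close>

datatype 's pp = PP nat "('s lterm \<times> 's lterm) list"

primrec pp_formula :: "('s, 'c) ring_scheme \<Rightarrow> nat \<Rightarrow> 's pp \<Rightarrow> bool" where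
  "pp_formula S n (PP l E) \<longleftrightarrow>
    (\<forall>(t, u)\<in>set E. lterm_scalars t \<union> lterm_scalars u \<subseteq> carrier S \<and>
                      lterm_vars t \<union> lterm_vars u \<subseteq> {..<n + l})"

text \<open>Finite powers are sets of lists, so that \<open>M\<^sup>m \<times> M\<^sup>n\<close> is identified with
  \<open>M\<^bsup>m + n\<^esup>\<close> by concatenation.\<close>

definition mpower :: "('s, 'm, 'c) module_scheme \<Rightarrow> nat \<Rightarrow> 'm list set" where
  "mpower M n = {xs. length xs = n \<and> set xs \<subseteq> carrier M}"

primrec pp_sat :: "('s, 'm, 'c) module_scheme \<Rightarrow> 'm list \<Rightarrow> 's pp \<Rightarrow> bool" where
  "pp_sat M xs (PP l E) \<longleftrightarrow>
    (\<exists>ys\<in>mpower M l. \<forall>(t, u)\<in>set E. lterm_eval M (xs @ ys) t = lterm_eval M (xs @ ys) u)"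

text \<open>Definability with parameters \<open>cs\<close>.\<close>

definition pp_definable ::
    "('s, 'c) ring_scheme \<Rightarrow> ('s, 'm, 'd) module_scheme \<Rightarrow> nat \<Rightarrow> 'm list set \<Rightarrow> bool" where
  "pp_definable S M n A \<longleftrightarrow>
    (\<exists>p cs \<phi>. cs \<in> mpower M p \<and> pp_formula S (n + p) \<phi> \<and>
              A = {xs \<in> mpower M n. pp_sat M (xs @ cs) \<phi>})"

definition pp_sets :: "('s, 'c) ring_scheme \<Rightarrow> ('s, 'm, 'd) module_scheme \<Rightarrow> 'm list set set" where
  "pp_sets S M = {A. A \<noteq> {} \<and> (\<exists>n. pp_definable S M n A)}"

definition pp_isomorphism :: "('s, 'c) ring_scheme \<Rightarrow> ('s, 'm, 'd) module_scheme \<Rightarrow>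
    ('m list set \<times> 'm list set) set" where
  "pp_isomorphism S M = {(A, B). A \<in> pp_sets S M \<and> B \<in> pp_sets S M \<and>
    (\<exists>f n. bij_betw f A B \<and> pp_definable S M n {xs @ f xs | xs. xs \<in> A})}"

definition list_times :: "'m list set \<Rightarrow> 'm list set \<Rightarrow> 'm list set" where
  "list_times A B = {xs @ ys | xs ys. xs \<in> A \<and> ys \<in> B}"

text \<open>The product of two classes is the class of \<open>A \<times> B\<close> for representatives \<open>A\<close>, \<open>B\<close>;
  the union over all representatives collapses because isomorphism is compatible with
  products. The unit is the class of the one-point set \<open>M\<^sup>0\<close>.\<close>

definition pp_class_monoid ::
    "('s, 'c) ring_scheme \<Rightarrow> ('s, 'm, 'd) module_scheme \<Rightarrow> 'm list set set monoid" where
  "pp_class_monoid S M =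
    \<lparr>carrier = pp_sets S M // pp_isomorphism S M,
     monoid.mult = (\<lambda>C D. \<Union>A\<in>C. \<Union>B\<in>D. pp_isomorphism S M `` {list_times A B}),
     one = pp_isomorphism S M `` {mpower M 0}\<rparr>"

definition multiples_monoid :: "nat \<Rightarrow> nat monoid" where
  "multiples_monoid q = \<lparr>carrier = range (\<lambda>n. q * n), monoid.mult = (+), one = 0\<rparr>"

definition nat_monoid :: "nat monoid" where
  "nat_monoid = \<lparr>carrier = UNIV, monoid.mult = (+), one = 0\<rparr>"

end

theory Submission
  imports Defs
begin

text \<open>A pp-definable set \<open>A\<close> is closed under \<open>(a, b, c) \<mapsto> a + h(b) - h(c)\<close> for every
  endomorphism \<open>h\<close> of the module, because the parameters cancel. Let \<open>\<epsilon>\<^sub>i\<close> be a primitive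
  idempotent of the \<open>i\<close>-th block. Since \<open>M\<close> is semisimple, its endomorphisms act transitively on
  the nonzero elements of \<open>V\<^sub>i = M\<epsilon>\<^sub>i\<close>, so a definable subset of \<open>V\<^sub>i\<close> with two elements is all of
  \<open>V\<^sub>i\<close>. Consequently the coordinate maps \<open>a \<mapsto> a\<^sub>j s\<close> with \<open>s = s\<epsilon>\<^sub>i\<close> behave like the elements of a
  matroid on \<open>A\<close>: a maximal family \<open>J\<close> of them that maps \<open>A\<close> onto \<open>\<Prod>\<^bsub>c\<in>J\<^esub> V\<^bsub>i(c)\<^esub>\<close> is
  injective, and by the exchange property the number of coordinates of each type \<open>i\<close> in \<open>J\<close> depends
  only on \<open>A\<close>. (An exchange preserves types because multiplication by \<open>e\<^sub>i\<close> is an endomorphism that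
  fixes \<open>V\<^sub>i\<close> and kills the other \<open>V\<^sub>j\<close>.) This dimension vector classifies definable sets up to
  definable bijection: the graph of a bijection \<open>A \<rightarrow> B\<close> has both a basis of \<open>A\<close> and a basis of \<open>B\<close>
  as a basis, and matching bases of the same type define a bijection.\<close>

section \<open>Definable sets\<close>

text \<open>Needed to give the variables of two formulas disjoint places in one longer list when a
  product of definable sets is formed.\<close>

primrec lterm_rename :: "(nat \<Rightarrow> nat) \<Rightarrow> 's lterm \<Rightarrow> 's lterm" where
  "lterm_rename r (LVar i) = LVar (r i)"
| "lterm_rename r LZero = LZero"
| "lterm_rename r (LPlus t u) = LPlus (lterm_rename r t) (lterm_rename r u)"
| "lterm_rename r (LMinus t) = LMinus (lterm_rename r t)"
| "lterm_rename r (LMult t s) = LMult (lterm_rename r t) s"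

lemma lterm_eval_rename:
  "(\<And>i. i \<in> lterm_vars t \<Longrightarrow> v ! r i = w ! i) \<Longrightarrow>
    lterm_eval M v (lterm_rename r t) = lterm_eval M w t"
  by (induction t) auto

lemma lterm_eval_cong:
  "(\<And>i. i \<in> lterm_vars t \<Longrightarrow> v ! i = w ! i) \<Longrightarrow> lterm_eval M v t = lterm_eval M w t"
  by (induction t) auto

lemma lterm_vars_rename: "lterm_vars (lterm_rename r t) = r ` lterm_vars t"
  by (induction t) auto

lemma lterm_scalars_rename: "lterm_scalars (lterm_rename r t) = lterm_scalars t"
  by (induction t) auto

lemma mpower_append: "xs \<in> mpower M m \<Longrightarrow> ys \<in> mpower M n \<Longrightarrow> xs @ ys \<in> mpower M (m + n)"
  by (auto simp: mpower_def)

lemma mpower_split: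
  assumes "zs \<in> mpower M (m + n)"
  obtains xs ys where "zs = xs @ ys" "xs \<in> mpower M m" "ys \<in> mpower M n"
proof
  show "zs = take m zs @ drop m zs" by simp
  show "take m zs \<in> mpower M m" "drop m zs \<in> mpower M n"
    using assms set_take_subset set_drop_subset by (fastforce simp: mpower_def)+
qed

section \<open>Systems of linear equations and the sets they define\<close>

definition wf_eqs :: "('s, 'c) ring_scheme \<Rightarrow> nat \<Rightarrow> ('s lterm \<times> 's lterm) set \<Rightarrow> bool" where
  "wf_eqs S n E \<longleftrightarrow> (\<forall>(t, u)\<in>E. lterm_scalars t \<union> lterm_scalars u \<subseteq> carrier S \<and>
                      lterm_vars t \<union> lterm_vars u \<subseteq> {..<n})"

lemma wf_eqsD:
  assumes "wf_eqs S n E" "(t, u) \<in> E"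
  shows "lterm_scalars t \<subseteq> carrier S" "lterm_scalars u \<subseteq> carrier S"
    and "lterm_vars t \<subseteq> {..<n}" "lterm_vars u \<subseteq> {..<n}"
  using assms by (auto simp: wf_eqs_def)

text \<open>Systems are sets rather than lists, so that a conjunction of systems is a union.\<close>

definition sat_eqs ::
    "('s, 'm, 'c) module_scheme \<Rightarrow> 'm list \<Rightarrow> ('s lterm \<times> 's lterm) set \<Rightarrow> bool" where
  "sat_eqs M v E \<longleftrightarrow> (\<forall>(t, u)\<in>E. lterm_eval M v t = lterm_eval M v u)"

lemma sat_eqs_Un: "sat_eqs M v (E \<union> F) \<longleftrightarrow> sat_eqs M v E \<and> sat_eqs M v F"
  by (simp add: sat_eqs_def ball_Un)

lemma wf_eqs_Un: "wf_eqs S n (E \<union> F) \<longleftrightarrow> wf_eqs S n E \<and> wf_eqs S n F"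
  by (simp add: wf_eqs_def ball_Un)

lemma sat_eqs_cong:
  assumes "wf_eqs S n E" "\<And>i. i < n \<Longrightarrow> v ! i = w ! i"
  shows "sat_eqs M v E \<longleftrightarrow> sat_eqs M w E"
proof -
  have "lterm_eval M v t = lterm_eval M w t \<and> lterm_eval M v u = lterm_eval M w u"
    if "(t, u) \<in> E" for t u
    using assms(2) wf_eqsD(3,4)[OF assms(1) that] by (intro conjI lterm_eval_cong) auto
  then show ?thesis by (force simp: sat_eqs_def)
qed

definition rename_eqs ::
    "(nat \<Rightarrow> nat) \<Rightarrow> ('s lterm \<times> 's lterm) set \<Rightarrow> ('s lterm \<times> 's lterm) set" where
  "rename_eqs r E = map_prod (lterm_rename r) (lterm_rename r) ` E"

lemma sat_eqs_rename:
  assumes "wf_eqs S n E" "\<And>i. i < n \<Longrightarrow> v ! r i = w ! i"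
  shows "sat_eqs M v (rename_eqs r E) \<longleftrightarrow> sat_eqs M w E"
proof -
  have "lterm_eval M v (lterm_rename r t) = lterm_eval M w t \<and>
      lterm_eval M v (lterm_rename r u) = lterm_eval M w u"
    if "(t, u) \<in> E" for t u
    using assms(2) wf_eqsD(3,4)[OF assms(1) that] by (intro conjI lterm_eval_rename) auto
  then show ?thesis by (force simp: sat_eqs_def rename_eqs_def)
qed

lemma wf_eqs_rename:
  assumes "wf_eqs S n E" "\<And>i. i < n \<Longrightarrow> r i < m"
  shows "wf_eqs S m (rename_eqs r E)"
proof -
  have "lterm_scalars t \<union> lterm_scalars u \<subseteq> carrier S \<and> r ` lterm_vars t \<union> r ` lterm_vars u \<subseteq> {..<m}"
    if "(t, u) \<in> E" for t u
    using wf_eqsD[OF assms(1) that] assms(2) by auto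
  then show ?thesis
    by (clarsimp simp: wf_eqs_def rename_eqs_def lterm_vars_rename lterm_scalars_rename)
qed

text \<open>The normal form used from here on: a valuation is a point, followed by the parameters,
  followed by the witnesses of the existential quantifier.\<close>

lemma pp_definable_iff:
  "pp_definable S M n A \<longleftrightarrow>
    (\<exists>p cs l E. cs \<in> mpower M p \<and> finite E \<and> wf_eqs S (n + p + l) E \<and>
       A = {xs \<in> mpower M n. \<exists>ys\<in>mpower M l. sat_eqs M (xs @ cs @ ys) E})" (is "_ \<longleftrightarrow> ?R")
proof
  assume "pp_definable S M n A"
  then obtain p cs \<phi> where *: "cs \<in> mpower M p" "pp_formula S (n + p) \<phi>"
      "A = {xs \<in> mpower M n. pp_sat M (xs @ cs) \<phi>}"
    unfolding pp_definable_def by blast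
  obtain l E where "\<phi> = PP l E" by (cases \<phi>)
  with * show ?R
    by (intro exI[of _ p] exI[of _ cs] exI[of _ l] exI[of _ "set E"])
      (simp add: wf_eqs_def sat_eqs_def)
next
  assume ?R
  then obtain p cs l E where *: "cs \<in> mpower M p" "finite E" "wf_eqs S (n + p + l) E"
      "A = {xs \<in> mpower M n. \<exists>ys\<in>mpower M l. sat_eqs M (xs @ cs @ ys) E}"
    by blast
  obtain F where "set F = E" using \<open>finite E\<close> finite_list by blast
  with * show "pp_definable S M n A"
    unfolding pp_definable_def
    by (intro exI[of _ p] exI[of _ cs] exI[of _ "PP l F"]) (simp add: wf_eqs_def sat_eqs_def)
qed

lemma pp_definable_subset: "pp_definable S M n A \<Longrightarrow> A \<subseteq> mpower M n"
  by (auto simp: pp_definable_def)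

text \<open>\<open>F\<close> involves only the first \<open>n\<close> variables, so it can be added
  under the quantifier of the system for \<open>A\<close> without touching parameters or
  witnesses.\<close>

lemma pp_definable_solutions:
  assumes "pp_definable S M n A" "finite F" "wf_eqs S n F"
  shows "pp_definable S M n {xs \<in> A. sat_eqs M xs F}"
proof -
  obtain p cs l E where *: "cs \<in> mpower M p" "finite E" "wf_eqs S (n + p + l) E"
      "A = {xs \<in> mpower M n. \<exists>ys\<in>mpower M l. sat_eqs M (xs @ cs @ ys) E}"
    using assms(1) unfolding pp_definable_iff by blast
  have "wf_eqs S (n + p + l) F"
    using assms(3) by (force simp: wf_eqs_def)
  moreover have "sat_eqs M (xs @ cs @ ys) F \<longleftrightarrow> sat_eqs M xs F" if "xs \<in> mpower M n" for xs ys
    using that by (intro sat_eqs_cong[OF assms(3)]) (auto simp: mpower_def nth_append)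
  ultimately show ?thesis
    unfolding pp_definable_iff using * assms(2)
    by (intro exI[of _ p] exI[of _ cs] exI[of _ l] exI[of _ "E \<union> F"])
      (auto simp: sat_eqs_Un wf_eqs_Un)
qed

lemma pp_definable_mpower: "pp_definable S M n (mpower M n)"
  unfolding pp_definable_iff
  by (intro exI[of _ 0] exI[of _ "[]"] exI[of _ 0] exI[of _ "{}"])
    (auto simp: mpower_def wf_eqs_def sat_eqs_def)

text \<open>Two systems in disjoint variables can be conjoined under a joint quantifier; the work
  lies in the bookkeeping of positions.\<close>

lemma pp_definable_list_times:
  assumes "pp_definable S M n A" "pp_definable S M m B"
  shows "pp_definable S M (n + m) (list_times A B)"
proof -
  obtain p cs l E where A: "cs \<in> mpower M p" "finite E" "wf_eqs S (n + p + l) E"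
      "A = {xs \<in> mpower M n. \<exists>ys\<in>mpower M l. sat_eqs M (xs @ cs @ ys) E}"
    using assms(1) unfolding pp_definable_iff by blast
  obtain p' cs' l' E' where B: "cs' \<in> mpower M p'" "finite E'" "wf_eqs S (m + p' + l') E'"
      "B = {xs \<in> mpower M m. \<exists>ys\<in>mpower M l'. sat_eqs M (xs @ cs' @ ys) E'}"
    using assms(2) unfolding pp_definable_iff by blast
  \<comment> \<open>The joint valuation is ordered as points, parameters, witnesses:
    \<open>xs @ ys @ cs @ cs' @ zs @ zs'\<close>. The maps \<open>r\<close> and \<open>r'\<close>
    send the three blocks of each system to their places in it.\<close>
  define r where "r i = (if i < n then i else if i < n + p then i + m else i + m + p')" for i
  define r' where
    "r' i = (if i < m then i + n else if i < m + p' then i + n + p else i + n + p + l)" for i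
  define F where "F = rename_eqs r E \<union> rename_eqs r' E'"
  have F: "sat_eqs M ((xs @ ys) @ (cs @ cs') @ (zs @ zs')) F \<longleftrightarrow>
      sat_eqs M (xs @ cs @ zs) E \<and> sat_eqs M (ys @ cs' @ zs') E'"
    if "xs \<in> mpower M n" "ys \<in> mpower M m" "zs \<in> mpower M l" "zs' \<in> mpower M l'"
    for xs ys zs zs'
  proof -
    let ?v = "(xs @ ys) @ (cs @ cs') @ (zs @ zs')"
    have len: "length xs = n" "length ys = m" "length zs = l" "length zs' = l'"
        "length cs = p" "length cs' = p'"
      using that A(1) B(1) by (auto simp: mpower_def)
    have "?v ! r i = (xs @ cs @ zs) ! i" if "i < n + p + l" for i
    proof -
      have "i < n \<or> (\<exists>d<p. i = n + d) \<or> (\<exists>d<l. i = n + p + d)"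
        using that by presburger
      then show ?thesis using len by (elim disjE exE conjE) (simp_all add: r_def nth_append)
    qed
    moreover have "?v ! r' i = (ys @ cs' @ zs') ! i" if "i < m + p' + l'" for i
    proof -
      have "i < m \<or> (\<exists>d<p'. i = m + d) \<or> (\<exists>d<l'. i = m + p' + d)"
        using that by presburger
      then show ?thesis using len by (elim disjE exE conjE) (simp_all add: r'_def nth_append)
    qed
    ultimately show ?thesis
      unfolding F_def sat_eqs_Un
      using sat_eqs_rename[OF A(3), of ?v r "xs @ cs @ zs"]
        sat_eqs_rename[OF B(3), of ?v r' "ys @ cs' @ zs'"] by blast
  qed
  have "list_times A B = {us \<in> mpower M (n + m). \<exists>vs\<in>mpower M (l + l').
      sat_eqs M (us @ (cs @ cs') @ vs) F}" (is "_ = ?Q")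
  proof (intro equalityI subsetI)
    fix us assume "us \<in> list_times A B"
    then obtain xs ys where us: "us = xs @ ys" "xs \<in> A" "ys \<in> B"
      unfolding list_times_def by blast
    then obtain zs zs' where "zs \<in> mpower M l" "sat_eqs M (xs @ cs @ zs) E"
        "zs' \<in> mpower M l'" "sat_eqs M (ys @ cs' @ zs') E'"
      using A(4) B(4) by blast
    moreover have "xs \<in> mpower M n" "ys \<in> mpower M m" using us A(4) B(4) by auto
    ultimately show "us \<in> ?Q"
      using F[of xs ys zs zs'] us(1) mpower_append[of zs M l zs' l'] mpower_append[of xs M n ys m]
      by blast
  next
    fix us assume "us \<in> ?Q"
    then obtain vs where *: "us \<in> mpower M (n + m)" "vs \<in> mpower M (l + l')"
        "sat_eqs M (us @ (cs @ cs') @ vs) F" by blast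
    obtain xs ys where us: "us = xs @ ys" "xs \<in> mpower M n" "ys \<in> mpower M m"
      using mpower_split[OF *(1)] .
    obtain zs zs' where vs: "vs = zs @ zs'" "zs \<in> mpower M l" "zs' \<in> mpower M l'"
      using mpower_split[OF *(2)] .
    show "us \<in> list_times A B"
      using F[OF us(2,3) vs(2,3)] *(3) us vs A(4) B(4) by (auto simp: list_times_def)
  qed
  moreover have "wf_eqs S (n + m + (p + p') + (l + l')) F"
    unfolding F_def wf_eqs_Un
    by (intro conjI wf_eqs_rename[OF A(3)] wf_eqs_rename[OF B(3)]) (auto simp: r_def r'_def)
  moreover have "finite F" using A(2) B(2) by (simp add: F_def rename_eqs_def)
  moreover have "cs @ cs' \<in> mpower M (p + p')" using A(1) B(1) by (rule mpower_append)
  ultimately show ?thesis unfolding pp_definable_iff by blast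
qed

section \<open>Endomorphisms\<close>

context right_module
begin

lemma minus_zero_iff:
  assumes "x \<in> carrier M" "y \<in> carrier M"
  shows "x \<ominus>\<^bsub>M\<^esub> y = \<zero>\<^bsub>M\<^esub> \<longleftrightarrow> x = y"
  using assms M.minus_equality[of x "\<ominus>\<^bsub>M\<^esub> y"] by (auto simp: M.minus_eq M.r_neg)

lemma act_zero [simp]: "s \<in> carrier S \<Longrightarrow> s \<odot>\<^bsub>M\<^esub> \<zero>\<^bsub>M\<^esub> = \<zero>\<^bsub>M\<^esub>"
  using act_add[of s "\<zero>\<^bsub>M\<^esub>" "\<zero>\<^bsub>M\<^esub>"] act_closed[of s "\<zero>\<^bsub>M\<^esub>"] M.add.l_cancel_one by auto

lemma zero_act [simp]: "x \<in> carrier M \<Longrightarrow> \<zero>\<^bsub>S\<^esub> \<odot>\<^bsub>M\<^esub> x = \<zero>\<^bsub>M\<^esub>"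
  using add_act[of "\<zero>\<^bsub>S\<^esub>" "\<zero>\<^bsub>S\<^esub>" x] act_closed[of "\<zero>\<^bsub>S\<^esub>" x] M.add.l_cancel_one by auto

lemma act_minus:
  assumes "s \<in> carrier S" "x \<in> carrier M"
  shows "s \<odot>\<^bsub>M\<^esub> (\<ominus>\<^bsub>M\<^esub> x) = \<ominus>\<^bsub>M\<^esub> (s \<odot>\<^bsub>M\<^esub> x)"
  using act_add[of s "\<ominus>\<^bsub>M\<^esub> x" x] assms
  by (intro M.minus_equality[symmetric]) (auto simp: act_closed M.l_neg)

lemma minus_act:
  assumes "s \<in> carrier S" "x \<in> carrier M"
  shows "(\<ominus>\<^bsub>S\<^esub> s) \<odot>\<^bsub>M\<^esub> x = \<ominus>\<^bsub>M\<^esub> (s \<odot>\<^bsub>M\<^esub> x)"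
  using add_act[of "\<ominus>\<^bsub>S\<^esub> s" s x] assms
  by (intro M.minus_equality[symmetric]) (auto simp: act_closed S.l_neg)

definition endo :: "('m \<Rightarrow> 'm) set" where
  "endo = {h. h \<in> carrier M \<rightarrow> carrier M \<and>
     (\<forall>x\<in>carrier M. \<forall>y\<in>carrier M. h (x \<oplus>\<^bsub>M\<^esub> y) = h x \<oplus>\<^bsub>M\<^esub> h y) \<and>
     (\<forall>s\<in>carrier S. \<forall>x\<in>carrier M. h (s \<odot>\<^bsub>M\<^esub> x) = s \<odot>\<^bsub>M\<^esub> h x)}"

lemma endo_closed: "h \<in> endo \<Longrightarrow> x \<in> carrier M \<Longrightarrow> h x \<in> carrier M"
  by (auto simp: endo_def)

lemma endo_add:
  "h \<in> endo \<Longrightarrow> x \<in> carrier M \<Longrightarrow> y \<in> carrier M \<Longrightarrow> h (x \<oplus>\<^bsub>M\<^esub> y) = h x \<oplus>\<^bsub>M\<^esub> h y"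
  by (auto simp: endo_def)

lemma endo_act:
  "h \<in> endo \<Longrightarrow> s \<in> carrier S \<Longrightarrow> x \<in> carrier M \<Longrightarrow> h (s \<odot>\<^bsub>M\<^esub> x) = s \<odot>\<^bsub>M\<^esub> h x"
  by (auto simp: endo_def)

lemma endo_zero:
  assumes "h \<in> endo"
  shows "h \<zero>\<^bsub>M\<^esub> = \<zero>\<^bsub>M\<^esub>"
  using endo_act[OF assms, of "\<zero>\<^bsub>S\<^esub>" "\<zero>\<^bsub>M\<^esub>"] endo_closed[OF assms, of "\<zero>\<^bsub>M\<^esub>"] by simp

lemma endo_minus:
  assumes "h \<in> endo" "x \<in> carrier M"
  shows "h (\<ominus>\<^bsub>M\<^esub> x) = \<ominus>\<^bsub>M\<^esub> h x"
  using endo_add[OF assms(1), of "\<ominus>\<^bsub>M\<^esub> x" x] endo_zero[OF assms(1)] assms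
  by (intro M.minus_equality[symmetric]) (auto simp: endo_closed M.l_neg)

text \<open>Multiplication by a scalar is always additive; centrality is what makes it commute with
  all other scalars.\<close>

lemma central_act_endo:
  assumes "c \<in> carrier S" "\<And>s. s \<in> carrier S \<Longrightarrow> s \<otimes>\<^bsub>S\<^esub> c = c \<otimes>\<^bsub>S\<^esub> s"
  shows "(\<lambda>x. c \<odot>\<^bsub>M\<^esub> x) \<in> endo"
  using assms by (auto simp: endo_def act_closed act_add act_mult[symmetric])

section \<open>The ternary operation x + h(y) - h(z) and closure under it\<close>

definition shift :: "('m \<Rightarrow> 'm) \<Rightarrow> 'm \<Rightarrow> 'm \<Rightarrow> 'm \<Rightarrow> 'm" where
  "shift h x y z = x \<oplus>\<^bsub>M\<^esub> (h y \<ominus>\<^bsub>M\<^esub> h z)"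

lemma shift_closed:
  "h \<in> endo \<Longrightarrow> x \<in> carrier M \<Longrightarrow> y \<in> carrier M \<Longrightarrow> z \<in> carrier M \<Longrightarrow> shift h x y z \<in> carrier M"
  by (simp add: shift_def endo_closed)

text \<open>The two values of \<open>h\<close> cancel. This is why parameters, being the same in all
  three arguments, survive a shift although \<open>h\<close> may move them.\<close>

lemma shift_same:
  "h \<in> endo \<Longrightarrow> x \<in> carrier M \<Longrightarrow> y \<in> carrier M \<Longrightarrow> shift h x y y = x"
  by (simp add: shift_def endo_closed M.minus_eq M.r_neg)

lemma shift_add:
  assumes "h \<in> endo" "x \<in> carrier M" "y \<in> carrier M" "z \<in> carrier M"
    and "x' \<in> carrier M" "y' \<in> carrier M" "z' \<in> carrier M"
  shows "shift h (x \<oplus>\<^bsub>M\<^esub> x') (y \<oplus>\<^bsub>M\<^esub> y') (z \<oplus>\<^bsub>M\<^esub> z') = shift h x y z \<oplus>\<^bsub>M\<^esub> shift h x' y' z'"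
  using assms by (simp add: shift_def endo_closed endo_add M.minus_eq M.minus_add M.a_ac)

lemma shift_minus:
  assumes "h \<in> endo" "x \<in> carrier M" "y \<in> carrier M" "z \<in> carrier M"
  shows "shift h (\<ominus>\<^bsub>M\<^esub> x) (\<ominus>\<^bsub>M\<^esub> y) (\<ominus>\<^bsub>M\<^esub> z) = \<ominus>\<^bsub>M\<^esub> shift h x y z"
  using assms by (simp add: shift_def endo_closed endo_minus M.minus_eq M.minus_add M.a_ac)

lemma shift_act:
  assumes "h \<in> endo" "s \<in> carrier S" "x \<in> carrier M" "y \<in> carrier M" "z \<in> carrier M"
  shows "shift h (s \<odot>\<^bsub>M\<^esub> x) (s \<odot>\<^bsub>M\<^esub> y) (s \<odot>\<^bsub>M\<^esub> z) = s \<odot>\<^bsub>M\<^esub> shift h x y z"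
  using assms by (simp add: shift_def endo_closed endo_act act_closed act_add act_minus M.minus_eq)

definition shift_list :: "('m \<Rightarrow> 'm) \<Rightarrow> 'm list \<Rightarrow> 'm list \<Rightarrow> 'm list \<Rightarrow> 'm list" where
  "shift_list h a b c = map (\<lambda>j. shift h (a ! j) (b ! j) (c ! j)) [0..<length a]"

text \<open>Existence and exchange of bases are derived from this closure property instead of from a
  defining formula.\<close>

definition shift_closed_set :: "'m list set \<Rightarrow> bool" where
  "shift_closed_set A \<longleftrightarrow> (\<forall>h\<in>endo. \<forall>a\<in>A. \<forall>b\<in>A. \<forall>c\<in>A. shift_list h a b c \<in> A)"

lemma nth_mpower: "a \<in> mpower M n \<Longrightarrow> j < n \<Longrightarrow> a ! j \<in> carrier M"
  by (auto simp: mpower_def)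

lemma nth_shift_list:
  "a \<in> mpower M n \<Longrightarrow> j < n \<Longrightarrow> shift_list h a b c ! j = shift h (a ! j) (b ! j) (c ! j)"
  by (simp add: shift_list_def mpower_def)

lemma shift_list_mpower:
  assumes "h \<in> endo" "a \<in> mpower M n" "b \<in> mpower M n" "c \<in> mpower M n"
  shows "shift_list h a b c \<in> mpower M n"
  using assms by (auto simp: shift_list_def mpower_def intro!: shift_closed)

lemma shift_list_append:
  assumes "a \<in> mpower M n" "b \<in> mpower M n" "c \<in> mpower M n"
    and "a' \<in> mpower M m" "b' \<in> mpower M m" "c' \<in> mpower M m"
  shows "shift_list h (a @ a') (b @ b') (c @ c') = shift_list h a b c @ shift_list h a' b' c'"
  using assms by (intro nth_equalityI) (auto simp: shift_list_def mpower_def nth_append)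

lemma shift_list_same:
  assumes "h \<in> endo" "a \<in> mpower M n" "b \<in> mpower M n"
  shows "shift_list h a b b = a"
  using assms
  by (intro nth_equalityI) (auto simp: shift_list_def mpower_def intro!: shift_same)

lemma lterm_eval_closed:
  assumes "lterm_scalars t \<subseteq> carrier S" "lterm_vars t \<subseteq> {..<n}" "a \<in> mpower M n"
  shows "lterm_eval M a t \<in> carrier M"
  using assms by (induction t) (auto simp: nth_mpower act_closed)

lemma lterm_eval_shift:
  assumes "lterm_scalars t \<subseteq> carrier S" "lterm_vars t \<subseteq> {..<n}"
    and "h \<in> endo" "a \<in> mpower M n" "b \<in> mpower M n" "c \<in> mpower M n"
  shows "lterm_eval M (shift_list h a b c) t =
    shift h (lterm_eval M a t) (lterm_eval M b t) (lterm_eval M c t)"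
  using assms(1,2)
proof (induction t)
  case LZero
  then show ?case using assms(3) by (simp add: shift_same)
next
  case (LPlus t u)
  then show ?case using assms(3-) by (simp add: shift_add lterm_eval_closed[where n = n])
next
  case (LMinus t)
  then show ?case using assms(3-) by (simp add: shift_minus lterm_eval_closed[where n = n])
next
  case (LMult t s)
  then show ?case using assms(3-) by (simp add: shift_act lterm_eval_closed[where n = n])
qed (use assms in \<open>simp add: nth_shift_list\<close>)

text \<open>Terms commute with the shift, so shifting three points together with their witnesses
  gives a point and a witness that satisfy the same equations.\<close>

lemma pp_definable_shift_closed:
  assumes "pp_definable S M n A"
  shows "shift_closed_set A"
  unfolding shift_closed_set_def
proof (intro ballI)
  fix h x y z assume h: "h \<in> endo" and xyz: "x \<in> A" "y \<in> A" "z \<in> A"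
  obtain p cs l E where A: "cs \<in> mpower M p" "finite E" "wf_eqs S (n + p + l) E"
      "A = {xs \<in> mpower M n. \<exists>ys\<in>mpower M l. sat_eqs M (xs @ cs @ ys) E}"
    using assms unfolding pp_definable_iff by blast
  from xyz obtain x' y' z' where w: "x' \<in> mpower M l" "sat_eqs M (x @ cs @ x') E"
      "y' \<in> mpower M l" "sat_eqs M (y @ cs @ y') E" "z' \<in> mpower M l" "sat_eqs M (z @ cs @ z') E"
    unfolding A(4) by blast
  have m: "x \<in> mpower M n" "y \<in> mpower M n" "z \<in> mpower M n" using xyz A(4) by auto
  have M: "x @ cs @ x' \<in> mpower M (n + p + l)" "y @ cs @ y' \<in> mpower M (n + p + l)"
      "z @ cs @ z' \<in> mpower M (n + p + l)"
    using m w A(1) by (auto simp: mpower_def)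
  have "shift_list h (x @ cs @ x') (y @ cs @ y') (z @ cs @ z') =
      shift_list h x y z @ shift_list h (cs @ x') (cs @ y') (cs @ z')"
    using m w A(1) by (intro shift_list_append[where m = "p + l"] mpower_append) auto
  \<comment> \<open>All three valuations carry the same parameters, so the middle block is
    fixed.\<close>
  also have "shift_list h (cs @ x') (cs @ y') (cs @ z') = cs @ shift_list h x' y' z'"
    using w A(1) shift_list_append[OF A(1) A(1) A(1) w(1,3,5)] shift_list_same[OF h A(1) A(1)]
    by simp
  finally have eq: "shift_list h (x @ cs @ x') (y @ cs @ y') (z @ cs @ z') =
      shift_list h x y z @ cs @ shift_list h x' y' z'" .
  have "sat_eqs M (shift_list h (x @ cs @ x') (y @ cs @ y') (z @ cs @ z')) E"
    unfolding sat_eqs_def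
  proof clarify
    fix t u assume tu: "(t, u) \<in> E"
    have "lterm_eval M (v @ cs @ v') t = lterm_eval M (v @ cs @ v') u"
      if "sat_eqs M (v @ cs @ v') E" for v v'
      using that tu by (auto simp: sat_eqs_def)
    then show "lterm_eval M (shift_list h (x @ cs @ x') (y @ cs @ y') (z @ cs @ z')) t =
        lterm_eval M (shift_list h (x @ cs @ x') (y @ cs @ y') (z @ cs @ z')) u"
      using w wf_eqsD[OF A(3) tu] h M by (simp add: lterm_eval_shift)
  qed
  then show "shift_list h x y z \<in> A"
    unfolding eq A(4) using shift_list_mpower[OF h] m w by blast
qed

section \<open>Submodules\<close>

definition submod :: "'m set \<Rightarrow> bool" where
  "submod N \<longleftrightarrow> N \<subseteq> carrier M \<and> \<zero>\<^bsub>M\<^esub> \<in> N \<and> (\<forall>x\<in>N. \<forall>y\<in>N. x \<oplus>\<^bsub>M\<^esub> y \<in> N) \<and>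
    (\<forall>s\<in>carrier S. \<forall>x\<in>N. s \<odot>\<^bsub>M\<^esub> x \<in> N)"

lemma submodD:
  assumes "submod N"
  shows "N \<subseteq> carrier M" "\<zero>\<^bsub>M\<^esub> \<in> N" "x \<in> N \<Longrightarrow> y \<in> N \<Longrightarrow> x \<oplus>\<^bsub>M\<^esub> y \<in> N"
    and "s \<in> carrier S \<Longrightarrow> x \<in> N \<Longrightarrow> s \<odot>\<^bsub>M\<^esub> x \<in> N"
  using assms by (auto simp: submod_def)

lemma submod_minus:
  assumes "submod N" "x \<in> N"
  shows "\<ominus>\<^bsub>M\<^esub> x \<in> N"
proof -
  have "x \<in> carrier M" using assms submodD(1) by blast
  then have "\<ominus>\<^bsub>M\<^esub> x = (\<ominus>\<^bsub>S\<^esub> \<one>\<^bsub>S\<^esub>) \<odot>\<^bsub>M\<^esub> x" by (simp add: minus_act act_one)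
  then show ?thesis using assms by (simp add: submodD(4))
qed

text \<open>For a submodule \<open>N\<close> this is \<open>N + xS\<close>, the submodule generated
  by \<open>N\<close> and \<open>x\<close>.\<close>

definition add_cyclic :: "'m set \<Rightarrow> 'm \<Rightarrow> 'm set" where
  "add_cyclic N x = {n \<oplus>\<^bsub>M\<^esub> s \<odot>\<^bsub>M\<^esub> x | n s. n \<in> N \<and> s \<in> carrier S}"

lemma submod_add_cyclic:
  assumes N: "submod N" and x: "x \<in> carrier M"
  shows "submod (add_cyclic N x)" "N \<subseteq> add_cyclic N x" "x \<in> add_cyclic N x"
proof -
  have NM: "n \<in> carrier M" if "n \<in> N" for n using that submodD(1)[OF N] by blast
  show sub: "N \<subseteq> add_cyclic N x"
  proof
    fix n assume n: "n \<in> N"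
    then have "n = n \<oplus>\<^bsub>M\<^esub> \<zero>\<^bsub>S\<^esub> \<odot>\<^bsub>M\<^esub> x" using NM x by simp
    then show "n \<in> add_cyclic N x" unfolding add_cyclic_def using n by blast
  qed
  have "x = \<zero>\<^bsub>M\<^esub> \<oplus>\<^bsub>M\<^esub> \<one>\<^bsub>S\<^esub> \<odot>\<^bsub>M\<^esub> x" using x by (simp add: act_one)
  then show "x \<in> add_cyclic N x" unfolding add_cyclic_def using submodD(2)[OF N] by blast
  show "submod (add_cyclic N x)"
    unfolding submod_def
  proof (intro conjI ballI)
    show "add_cyclic N x \<subseteq> carrier M" using NM x by (auto simp: add_cyclic_def act_closed)
    show "\<zero>\<^bsub>M\<^esub> \<in> add_cyclic N x" using sub submodD(2)[OF N] by blast
  next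
    fix a b assume "a \<in> add_cyclic N x" "b \<in> add_cyclic N x"
    then obtain n s m t where *: "n \<in> N" "s \<in> carrier S" "a = n \<oplus>\<^bsub>M\<^esub> s \<odot>\<^bsub>M\<^esub> x"
        "m \<in> N" "t \<in> carrier S" "b = m \<oplus>\<^bsub>M\<^esub> t \<odot>\<^bsub>M\<^esub> x"
      unfolding add_cyclic_def by blast
    then have "a \<oplus>\<^bsub>M\<^esub> b = (n \<oplus>\<^bsub>M\<^esub> m) \<oplus>\<^bsub>M\<^esub> (s \<oplus>\<^bsub>S\<^esub> t) \<odot>\<^bsub>M\<^esub> x"
      using x NM by (simp add: add_act act_closed M.a_ac)
    then show "a \<oplus>\<^bsub>M\<^esub> b \<in> add_cyclic N x"
      unfolding add_cyclic_def using * submodD(3)[OF N] by blast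
  next
    fix t a assume t: "t \<in> carrier S" and "a \<in> add_cyclic N x"
    then obtain n s where *: "n \<in> N" "s \<in> carrier S" "a = n \<oplus>\<^bsub>M\<^esub> s \<odot>\<^bsub>M\<^esub> x"
      unfolding add_cyclic_def by blast
    then have "t \<odot>\<^bsub>M\<^esub> a = (t \<odot>\<^bsub>M\<^esub> n) \<oplus>\<^bsub>M\<^esub> (s \<otimes>\<^bsub>S\<^esub> t) \<odot>\<^bsub>M\<^esub> x"
      using x t NM by (simp add: act_add act_mult act_closed)
    then show "t \<odot>\<^bsub>M\<^esub> a \<in> add_cyclic N x"
      unfolding add_cyclic_def using * t submodD(4)[OF N] by blast
  qed
qed

end

section \<open>Bases of closed sets\<close>

text \<open>\<open>\<epsilon> i\<close> is a primitive idempotent of the \<open>i\<close>-th block, so that \<open>M\<epsilon>\<^sub>i\<close> is a vector space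
  over the division ring \<open>\<epsilon>\<^sub>i S \<epsilon>\<^sub>i\<close>; the elements of \<open>us\<close> are the matrix units in the first
  columns of the blocks, and \<open>us_generate\<close> says that they generate \<open>S\<close> as a right ideal.\<close>

locale block_module = right_module S M
  for S :: "('s, 'c) ring_scheme" (structure) and M :: "('s, 'm, 'd) module_scheme" (structure) +
  fixes I :: "'i set" and e \<epsilon> :: "'i \<Rightarrow> 's" and us :: "('i \<times> 's) set"
  assumes e_closed: "i \<in> I \<Longrightarrow> e i \<in> carrier S"
    and e_central: "\<lbrakk>i \<in> I; s \<in> carrier S\<rbrakk> \<Longrightarrow> s \<otimes>\<^bsub>S\<^esub> e i = e i \<otimes>\<^bsub>S\<^esub> s"
    and eps_closed: "i \<in> I \<Longrightarrow> \<epsilon> i \<in> carrier S"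
    and eps_idem: "i \<in> I \<Longrightarrow> \<epsilon> i \<otimes>\<^bsub>S\<^esub> \<epsilon> i = \<epsilon> i"
    and eps_e_same: "i \<in> I \<Longrightarrow> \<epsilon> i \<otimes>\<^bsub>S\<^esub> e i = \<epsilon> i"
    and eps_e_other: "\<lbrakk>i \<in> I; j \<in> I; i \<noteq> j\<rbrakk> \<Longrightarrow> \<epsilon> i \<otimes>\<^bsub>S\<^esub> e j = \<zero>\<^bsub>S\<^esub>"
    and eps_minimal: "\<lbrakk>i \<in> I; s \<in> carrier S; \<epsilon> i \<otimes>\<^bsub>S\<^esub> s \<noteq> \<zero>\<^bsub>S\<^esub>\<rbrakk>
      \<Longrightarrow> \<exists>t\<in>carrier S. (\<epsilon> i \<otimes>\<^bsub>S\<^esub> s) \<otimes>\<^bsub>S\<^esub> t = \<epsilon> i"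
    and us_finite: "finite us"
    and us_closed: "(i, u) \<in> us \<Longrightarrow> i \<in> I \<and> u \<in> carrier S \<and> u \<otimes>\<^bsub>S\<^esub> \<epsilon> i = u"
    and us_generate: "\<lbrakk>K \<subseteq> carrier S; \<zero>\<^bsub>S\<^esub> \<in> K; \<And>s t. s \<in> K \<Longrightarrow> t \<in> K \<Longrightarrow> s \<oplus>\<^bsub>S\<^esub> t \<in> K;
      \<And>s t. s \<in> K \<Longrightarrow> t \<in> carrier S \<Longrightarrow> s \<otimes>\<^bsub>S\<^esub> t \<in> K; snd ` us \<subseteq> K\<rbrakk> \<Longrightarrow> \<one>\<^bsub>S\<^esub> \<in> K"
    and eps_nonzero: "i \<in> I \<Longrightarrow> \<exists>v\<in>carrier M. v \<noteq> \<zero>\<^bsub>M\<^esub> \<and> \<epsilon> i \<odot>\<^bsub>M\<^esub> v = v"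
begin

text \<open>The space \<open>M\<epsilon>\<^sub>i\<close>, written as a set of fixed points; for an
  idempotent this is the same as the image.\<close>

definition V :: "'i \<Rightarrow> 'm set" where
  "V i = {v \<in> carrier M. \<epsilon> i \<odot>\<^bsub>M\<^esub> v = v}"

lemma V_carrier: "v \<in> V i \<Longrightarrow> v \<in> carrier M"
  by (simp add: V_def)

lemma V_zero: "i \<in> I \<Longrightarrow> \<zero>\<^bsub>M\<^esub> \<in> V i"
  by (simp add: V_def eps_closed)

lemma V_minus: "i \<in> I \<Longrightarrow> v \<in> V i \<Longrightarrow> w \<in> V i \<Longrightarrow> v \<ominus>\<^bsub>M\<^esub> w \<in> V i"
  by (simp add: V_def eps_closed act_add act_minus M.minus_eq)

lemma V_distinct: "i \<in> I \<Longrightarrow> v \<in> V i \<Longrightarrow> \<exists>w\<in>V i. w \<noteq> v"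
  using V_zero[of i] eps_nonzero[of i] unfolding V_def by (cases "v = \<zero>\<^bsub>M\<^esub>") auto

text \<open>Since \<open>v\<close> is fixed by \<open>\<epsilon> i\<close>, the scalar can be moved
  into the right ideal generated by \<open>\<epsilon> i\<close>, where \<open>eps_minimal\<close>
  applies.\<close>

lemma act_V: "i \<in> I \<Longrightarrow> s \<in> carrier S \<Longrightarrow> v \<in> V i \<Longrightarrow> s \<odot>\<^bsub>M\<^esub> v = (\<epsilon> i \<otimes>\<^bsub>S\<^esub> s) \<odot>\<^bsub>M\<^esub> v"
  by (simp add: V_def act_mult eps_closed)

lemma act_e_same: "i \<in> I \<Longrightarrow> v \<in> V i \<Longrightarrow> e i \<odot>\<^bsub>M\<^esub> v = v"
  using act_V[of i "e i" v] by (simp add: e_closed eps_e_same V_def)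

lemma act_e_other: "i \<in> I \<Longrightarrow> j \<in> I \<Longrightarrow> i \<noteq> j \<Longrightarrow> v \<in> V i \<Longrightarrow> e j \<odot>\<^bsub>M\<^esub> v = \<zero>\<^bsub>M\<^esub>"
  using act_V[of i "e j" v] by (simp add: e_closed eps_e_other V_def)

text \<open>Minimality of the right ideal of \<open>\<epsilon> i\<close> carries over to
  \<open>vS\<close>: each of its nonzero elements generates \<open>v\<close> again, so
  \<open>vS\<close> has no proper nonzero submodule.\<close>

lemma V_simple:
  assumes "i \<in> I" "v \<in> V i" "s \<in> carrier S" "s \<odot>\<^bsub>M\<^esub> v \<noteq> \<zero>\<^bsub>M\<^esub>"
  obtains t where "t \<in> carrier S" "t \<odot>\<^bsub>M\<^esub> (s \<odot>\<^bsub>M\<^esub> v) = v"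
proof -
  have "\<epsilon> i \<otimes>\<^bsub>S\<^esub> s \<noteq> \<zero>\<^bsub>S\<^esub>" using assms act_V[OF assms(1,3,2)] V_carrier by auto
  then obtain t where t: "t \<in> carrier S" "(\<epsilon> i \<otimes>\<^bsub>S\<^esub> s) \<otimes>\<^bsub>S\<^esub> t = \<epsilon> i"
    using eps_minimal assms(1,3) by blast
  have "t \<odot>\<^bsub>M\<^esub> (s \<odot>\<^bsub>M\<^esub> v) = ((\<epsilon> i \<otimes>\<^bsub>S\<^esub> s) \<otimes>\<^bsub>S\<^esub> t) \<odot>\<^bsub>M\<^esub> v"
    using assms t(1) act_V[OF assms(1,3,2)] by (simp add: act_mult eps_closed V_carrier)
  also have "\<dots> = v" unfolding t(2) using assms(2) by (simp add: V_def)
  finally show ?thesis using that t(1) by blast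
qed

lemma us_act_V:
  assumes "(i, u) \<in> us" "x \<in> carrier M"
  shows "u \<odot>\<^bsub>M\<^esub> x \<in> V i"
proof -
  have "i \<in> I" "u \<in> carrier S" "u \<otimes>\<^bsub>S\<^esub> \<epsilon> i = u" using us_closed assms(1) by auto
  then show ?thesis
    using act_mult[of u "\<epsilon> i" x] assms(2) by (simp add: V_def act_closed eps_closed)
qed

text \<open>The scalars that send \<open>x\<close> into \<open>N\<close> form a right ideal. It
  contains the generators in \<open>us\<close>, hence the identity.\<close>

lemma submod_generate:
  assumes "submod N" "x \<in> carrier M" "\<And>i u. (i, u) \<in> us \<Longrightarrow> u \<odot>\<^bsub>M\<^esub> x \<in> N"
  shows "x \<in> N"
proof -
  have "\<one>\<^bsub>S\<^esub> \<in> {s \<in> carrier S. s \<odot>\<^bsub>M\<^esub> x \<in> N}"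
  proof (rule us_generate)
    show "snd ` us \<subseteq> {s \<in> carrier S. s \<odot>\<^bsub>M\<^esub> x \<in> N}" using assms(3) us_closed by auto
  qed (use assms submodD[OF assms(1)] in \<open>auto simp: add_act act_mult\<close>)
  then show ?thesis using assms(2) by (simp add: act_one)
qed

lemma submod_zero: "submod {\<zero>\<^bsub>M\<^esub>}"
  by (auto simp: submod_def)

text \<open>The difference of \<open>x\<close> and \<open>y\<close> is sent into the zero submodule
  by all generators, so it is itself zero.\<close>

lemma us_separate:
  assumes "x \<in> carrier M" "y \<in> carrier M" "\<And>i u. (i, u) \<in> us \<Longrightarrow> u \<odot>\<^bsub>M\<^esub> x = u \<odot>\<^bsub>M\<^esub> y"
  shows "x = y"
proof -
  have "x \<ominus>\<^bsub>M\<^esub> y \<in> {\<zero>\<^bsub>M\<^esub>}"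
  proof (rule submod_generate[OF submod_zero])
    fix i u assume "(i, u) \<in> us"
    then show "u \<odot>\<^bsub>M\<^esub> (x \<ominus>\<^bsub>M\<^esub> y) \<in> {\<zero>\<^bsub>M\<^esub>}"
      using assms us_closed[of i u] assms(3)[of i u]
      by (simp add: M.minus_eq act_add act_minus act_closed M.r_neg)
  qed (use assms in simp)
  then show ?thesis using assms by (simp add: minus_zero_iff)
qed

text \<open>A maximal submodule \<open>N\<close> with \<open>N \<inter> pS = 0\<close> is a complement of \<open>pS\<close>, since \<open>M\<close> is generated by
  the simple modules \<open>xS\<close> with \<open>x \<in> M\<epsilon>\<^sub>j\<close>; on \<open>N \<oplus> pS\<close> let the endomorphism be
  \<open>n + ps \<mapsto> vs\<close>.\<close>

lemma endo_transitive:
  assumes i: "i \<in> I" and p: "p \<in> V i" "p \<noteq> \<zero>\<^bsub>M\<^esub>" and v: "v \<in> V i"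
  obtains h where "h \<in> endo" "h p = v"
proof -
  have pM: "p \<in> carrier M" and vM: "v \<in> carrier M" using p v V_carrier by auto
  define P where "P = (\<lambda>s. s \<odot>\<^bsub>M\<^esub> p) ` carrier S"
  define \<N> where "\<N> = {N. submod N \<and> N \<inter> P \<subseteq> {\<zero>\<^bsub>M\<^esub>}}"
  \<comment> \<open>Unions of nonempty chains are again submodules that meet \<open>P\<close> only
    in zero, so Zorn's lemma gives a maximal such \<open>N\<close>.\<close>
  have "\<exists>N\<in>\<N>. \<forall>N'\<in>\<N>. N \<subseteq> N' \<longrightarrow> N' = N"
  proof (rule subset_Zorn_nonempty)
    show "\<N> \<noteq> {}" using submod_zero unfolding \<N>_def by blast
    fix \<C> assume ne: "\<C> \<noteq> {}" and "subset.chain \<N> \<C>"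
    then have C: "\<C> \<subseteq> \<N>" and lin: "\<And>A B. A \<in> \<C> \<Longrightarrow> B \<in> \<C> \<Longrightarrow> A \<subseteq> B \<or> B \<subseteq> A"
      by (auto simp: subset_chain_def)
    have sm: "submod A" if "A \<in> \<C>" for A using that C by (auto simp: \<N>_def)
    have "submod (\<Union>\<C>)"
      unfolding submod_def
    proof (intro conjI ballI)
      show "\<Union>\<C> \<subseteq> carrier M" using sm submodD(1) by blast
      show "\<zero>\<^bsub>M\<^esub> \<in> \<Union>\<C>" using ne sm submodD(2) by blast
    next
      fix x y assume "x \<in> \<Union>\<C>" "y \<in> \<Union>\<C>"
      then obtain A B where "A \<in> \<C>" "B \<in> \<C>" "x \<in> A" "y \<in> B" by blast
      then obtain C where "C \<in> \<C>" "x \<in> C" "y \<in> C" using lin[of A B] by blast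
      then show "x \<oplus>\<^bsub>M\<^esub> y \<in> \<Union>\<C>" using sm submodD(3) by blast
    next
      fix s x assume "s \<in> carrier S" "x \<in> \<Union>\<C>"
      then show "s \<odot>\<^bsub>M\<^esub> x \<in> \<Union>\<C>" using sm submodD(4) by blast
    qed
    moreover have "\<Union>\<C> \<inter> P \<subseteq> {\<zero>\<^bsub>M\<^esub>}" using C by (auto simp: \<N>_def)
    ultimately show "\<Union>\<C> \<in> \<N>" by (simp add: \<N>_def)
  qed
  then obtain N where N\<N>: "N \<in> \<N>" and max\<N>: "\<forall>N'\<in>\<N>. N \<subseteq> N' \<longrightarrow> N' = N" by (rule bexE)
  have N: "submod N" "N \<inter> P \<subseteq> {\<zero>\<^bsub>M\<^esub>}" using N\<N> by (auto simp: \<N>_def)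
  have max: "N' = N" if "submod N'" "N' \<inter> P \<subseteq> {\<zero>\<^bsub>M\<^esub>}" "N \<subseteq> N'" for N'
    using max\<N> that by (auto simp: \<N>_def)
  have NM: "n \<in> carrier M" if "n \<in> N" for n using that submodD(1)[OF N(1)] by blast
  define Q where "Q = add_cyclic N p"
  have Q: "submod Q" "N \<subseteq> Q" "p \<in> Q" unfolding Q_def using submod_add_cyclic[OF N(1) pM] by auto
  \<comment> \<open>If \<open>x\<close> were outside \<open>Q\<close>, then \<open>N + xS\<close>
    would still meet \<open>pS\<close> only in zero, against the maximality of
    \<open>N\<close>.\<close>
  have VQ: "x \<in> Q" if j: "j \<in> I" and x: "x \<in> V j" for j x
  proof (rule ccontr)
    assume nQ: "x \<notin> Q"
    have xM: "x \<in> carrier M" using x V_carrier by blast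
    note N' = submod_add_cyclic[OF N(1) xM]
    have "y = \<zero>\<^bsub>M\<^esub>" if "y \<in> add_cyclic N x" "y \<in> P" for y
    proof -
      obtain n s where ns: "n \<in> N" "s \<in> carrier S" "y = n \<oplus>\<^bsub>M\<^esub> s \<odot>\<^bsub>M\<^esub> x"
        using \<open>y \<in> add_cyclic N x\<close> unfolding add_cyclic_def by blast
      have sx: "s \<odot>\<^bsub>M\<^esub> x \<in> carrier M" using ns xM act_closed by blast
      have "y \<in> Q" using \<open>y \<in> P\<close> submodD(4)[OF Q(1)] Q(3) by (auto simp: P_def)
      moreover have "s \<odot>\<^bsub>M\<^esub> x = \<ominus>\<^bsub>M\<^esub> n \<oplus>\<^bsub>M\<^esub> y"
        using ns sx NM by (simp add: M.r_neg1)
      moreover have "\<ominus>\<^bsub>M\<^esub> n \<in> Q" using submod_minus[OF N(1)] ns Q(2) by blast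
      ultimately have "s \<odot>\<^bsub>M\<^esub> x \<in> Q" using submodD(3)[OF Q(1)] by simp
      \<comment> \<open>A nonzero \<open>xs\<close> generates \<open>x\<close>, and
        \<open>xs\<close> lies in \<open>Q\<close>, so \<open>x\<close> would lie in
        \<open>Q\<close> as well.\<close>
      have "s \<odot>\<^bsub>M\<^esub> x = \<zero>\<^bsub>M\<^esub>"
      proof (rule ccontr)
        assume "s \<odot>\<^bsub>M\<^esub> x \<noteq> \<zero>\<^bsub>M\<^esub>"
        then obtain t where "t \<in> carrier S" "t \<odot>\<^bsub>M\<^esub> (s \<odot>\<^bsub>M\<^esub> x) = x"
          using V_simple[OF j x ns(2)] by blast
        then show False using submodD(4)[OF Q(1)] \<open>s \<odot>\<^bsub>M\<^esub> x \<in> Q\<close> nQ by metis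
      qed
      then have "y = n" using ns NM by simp
      then show ?thesis using N(2) ns(1) \<open>y \<in> P\<close> by blast
    qed
    then have "add_cyclic N x = N" using max N' by blast
    then show False using N'(3) Q(2) nQ by blast
  qed
  have QM: "x \<in> Q" if "x \<in> carrier M" for x
    using submod_generate[OF Q(1) that] us_act_V that us_closed VQ by blast
  \<comment> \<open>The assignment of \<open>vs\<close> to \<open>n + ps\<close> is well defined:
    for the difference \<open>d\<close> of \<open>s\<close> and \<open>t\<close>, the element
    \<open>pd\<close> lies both in \<open>N\<close> and in \<open>pS\<close>, so it is zero.\<close>
  have uniq: "s \<odot>\<^bsub>M\<^esub> v = t \<odot>\<^bsub>M\<^esub> v"
    if st: "n \<in> N" "m \<in> N" "s \<in> carrier S" "t \<in> carrier S"
      "n \<oplus>\<^bsub>M\<^esub> s \<odot>\<^bsub>M\<^esub> p = m \<oplus>\<^bsub>M\<^esub> t \<odot>\<^bsub>M\<^esub> p" for n m s t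
  proof -
    define d where "d = s \<oplus>\<^bsub>S\<^esub> \<ominus>\<^bsub>S\<^esub> t"
    have d: "d \<in> carrier S" using st d_def by simp
    have spM: "s \<odot>\<^bsub>M\<^esub> p \<in> carrier M" "t \<odot>\<^bsub>M\<^esub> p \<in> carrier M" using st pM act_closed by auto
    have nm: "n \<in> carrier M" "m \<in> carrier M" using st NM by auto
    have "s \<odot>\<^bsub>M\<^esub> p = \<ominus>\<^bsub>M\<^esub> n \<oplus>\<^bsub>M\<^esub> (m \<oplus>\<^bsub>M\<^esub> t \<odot>\<^bsub>M\<^esub> p)"
      unfolding st(5)[symmetric] using nm spM by (simp add: M.r_neg1)
    then have "d \<odot>\<^bsub>M\<^esub> p = (\<ominus>\<^bsub>M\<^esub> n \<oplus>\<^bsub>M\<^esub> (m \<oplus>\<^bsub>M\<^esub> t \<odot>\<^bsub>M\<^esub> p)) \<oplus>\<^bsub>M\<^esub> \<ominus>\<^bsub>M\<^esub> (t \<odot>\<^bsub>M\<^esub> p)"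
      unfolding d_def using st pM by (simp add: add_act minus_act)
    also have "\<dots> = \<ominus>\<^bsub>M\<^esub> n \<oplus>\<^bsub>M\<^esub> m" using nm spM by (simp add: M.a_assoc M.r_neg)
    finally have "d \<odot>\<^bsub>M\<^esub> p \<in> N" using st submodD(3)[OF N(1)] submod_minus[OF N(1)] by simp
    then have d0: "d \<odot>\<^bsub>M\<^esub> p = \<zero>\<^bsub>M\<^esub>" using N(2) d unfolding P_def by blast
    \<comment> \<open>Otherwise this product could be multiplied back to
      \<open>\<epsilon> i\<close>, which would give \<open>p = 0\<close>. Hence \<open>d\<close>
      annihilates all of \<open>V i\<close>, in particular \<open>v\<close>.\<close>
    have "\<epsilon> i \<otimes>\<^bsub>S\<^esub> d = \<zero>\<^bsub>S\<^esub>"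
    proof (rule ccontr)
      assume "\<epsilon> i \<otimes>\<^bsub>S\<^esub> d \<noteq> \<zero>\<^bsub>S\<^esub>"
      then obtain r where r: "r \<in> carrier S" "(\<epsilon> i \<otimes>\<^bsub>S\<^esub> d) \<otimes>\<^bsub>S\<^esub> r = \<epsilon> i"
        using eps_minimal i d by blast
      have "p = ((\<epsilon> i \<otimes>\<^bsub>S\<^esub> d) \<otimes>\<^bsub>S\<^esub> r) \<odot>\<^bsub>M\<^esub> p" unfolding r(2) using p(1) by (simp add: V_def)
      also have "\<dots> = r \<odot>\<^bsub>M\<^esub> (d \<odot>\<^bsub>M\<^esub> p)"
        using act_V[OF i d p(1)] i d r(1) pM by (simp add: act_mult eps_closed)
      also have "\<dots> = \<zero>\<^bsub>M\<^esub>" using d0 r(1) by simp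
      finally show False using p(2) by simp
    qed
    then have "d \<odot>\<^bsub>M\<^esub> v = \<zero>\<^bsub>M\<^esub>" using act_V[OF i d v] vM by simp
    then have "s \<odot>\<^bsub>M\<^esub> v \<ominus>\<^bsub>M\<^esub> t \<odot>\<^bsub>M\<^esub> v = \<zero>\<^bsub>M\<^esub>"
      unfolding d_def M.minus_eq using st vM by (simp add: add_act minus_act)
    then show ?thesis using st vM by (simp add: act_closed minus_zero_iff)
  qed
  \<comment> \<open>\<open>uniq\<close> makes the value independent of the decomposition of
    \<open>x\<close>, and \<open>QM\<close> provides a decomposition for each \<open>x\<close> in
    the module.\<close>
  define h where "h x = (THE y. \<exists>n\<in>N. \<exists>s\<in>carrier S. x = n \<oplus>\<^bsub>M\<^esub> s \<odot>\<^bsub>M\<^esub> p \<and> y = s \<odot>\<^bsub>M\<^esub> v)" for x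
  have h: "h (n \<oplus>\<^bsub>M\<^esub> s \<odot>\<^bsub>M\<^esub> p) = s \<odot>\<^bsub>M\<^esub> v" if "n \<in> N" "s \<in> carrier S" for n s
    unfolding h_def
  proof (rule the_equality)
    fix y assume "\<exists>m\<in>N. \<exists>t\<in>carrier S. n \<oplus>\<^bsub>M\<^esub> s \<odot>\<^bsub>M\<^esub> p = m \<oplus>\<^bsub>M\<^esub> t \<odot>\<^bsub>M\<^esub> p \<and> y = t \<odot>\<^bsub>M\<^esub> v"
    then obtain m t where "m \<in> N" "t \<in> carrier S"
        "n \<oplus>\<^bsub>M\<^esub> s \<odot>\<^bsub>M\<^esub> p = m \<oplus>\<^bsub>M\<^esub> t \<odot>\<^bsub>M\<^esub> p" "y = t \<odot>\<^bsub>M\<^esub> v" by (elim bexE conjE)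
    then show "y = s \<odot>\<^bsub>M\<^esub> v" using uniq[of n m s t] that by simp
  qed (use that in auto)
  have ex: "\<exists>n\<in>N. \<exists>s\<in>carrier S. x = n \<oplus>\<^bsub>M\<^esub> s \<odot>\<^bsub>M\<^esub> p" if "x \<in> carrier M" for x
    using QM[OF that] unfolding Q_def add_cyclic_def by blast
  have "h \<in> endo"
    unfolding endo_def
  proof (intro CollectI conjI ballI funcsetI)
    fix x assume "x \<in> carrier M"
    then show "h x \<in> carrier M" using ex[of x] h vM act_closed by auto
  next
    fix x y assume "x \<in> carrier M" "y \<in> carrier M"
    then obtain n s m t where *: "n \<in> N" "s \<in> carrier S" "x = n \<oplus>\<^bsub>M\<^esub> s \<odot>\<^bsub>M\<^esub> p"
        "m \<in> N" "t \<in> carrier S" "y = m \<oplus>\<^bsub>M\<^esub> t \<odot>\<^bsub>M\<^esub> p"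
      using ex by meson
    have "x \<oplus>\<^bsub>M\<^esub> y = (n \<oplus>\<^bsub>M\<^esub> m) \<oplus>\<^bsub>M\<^esub> (s \<oplus>\<^bsub>S\<^esub> t) \<odot>\<^bsub>M\<^esub> p"
      using * pM NM by (simp add: add_act act_closed M.a_ac)
    then show "h (x \<oplus>\<^bsub>M\<^esub> y) = h x \<oplus>\<^bsub>M\<^esub> h y"
      using * h vM submodD(3)[OF N(1)] by (simp add: add_act)
  next
    fix t x assume t: "t \<in> carrier S" and "x \<in> carrier M"
    then obtain n s where *: "n \<in> N" "s \<in> carrier S" "x = n \<oplus>\<^bsub>M\<^esub> s \<odot>\<^bsub>M\<^esub> p"
      using ex by meson
    have "t \<odot>\<^bsub>M\<^esub> x = (t \<odot>\<^bsub>M\<^esub> n) \<oplus>\<^bsub>M\<^esub> (s \<otimes>\<^bsub>S\<^esub> t) \<odot>\<^bsub>M\<^esub> p"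
      using * pM t NM by (simp add: act_add act_mult act_closed)
    then show "h (t \<odot>\<^bsub>M\<^esub> x) = t \<odot>\<^bsub>M\<^esub> h x"
      using * t h vM submodD(4)[OF N(1)] by (simp add: act_mult)
  qed
  moreover have "h p = v"
    using h[of "\<zero>\<^bsub>M\<^esub>" "\<one>\<^bsub>S\<^esub>"] submodD(2)[OF N(1)] pM vM by (simp add: act_one)
  ultimately show ?thesis using that by blast
qed

text \<open>The endomorphism is chosen to send the nonzero difference of \<open>y\<close> and
  \<open>z\<close> to the difference of \<open>t\<close> and \<open>x\<close>.\<close>

lemma shift_reach:
  assumes i: "i \<in> I" and "x \<in> V i" "y \<in> V i" "z \<in> V i" "y \<noteq> z" "t \<in> V i"
  obtains h where "h \<in> endo" "shift h x y z = t"
proof -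
  have M: "x \<in> carrier M" "y \<in> carrier M" "z \<in> carrier M" "t \<in> carrier M"
    using assms V_carrier by auto
  have "y \<ominus>\<^bsub>M\<^esub> z \<in> V i" "t \<ominus>\<^bsub>M\<^esub> x \<in> V i" using assms V_minus by auto
  moreover have "y \<ominus>\<^bsub>M\<^esub> z \<noteq> \<zero>\<^bsub>M\<^esub>" using M assms by (simp add: minus_zero_iff)
  ultimately obtain h where h: "h \<in> endo" "h (y \<ominus>\<^bsub>M\<^esub> z) = t \<ominus>\<^bsub>M\<^esub> x"
    using endo_transitive[OF i] by blast
  then have "h y \<ominus>\<^bsub>M\<^esub> h z = t \<ominus>\<^bsub>M\<^esub> x" using M by (simp add: M.minus_eq endo_add endo_minus)
  then have "shift h x y z = t"
    using M by (simp add: shift_def M.minus_eq M.r_neg M.a_lcomm[of x t])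
  then show ?thesis using that h(1) by blast
qed

section \<open>Coordinate maps and the existence of bases\<close>

definition coords :: "nat \<Rightarrow> (nat \<times> 'i \<times> 's) set" where
  "coords n = {(j, i, s). j < n \<and> i \<in> I \<and> s \<in> carrier S \<and> s \<otimes>\<^bsub>S\<^esub> \<epsilon> i = s}"

text \<open>The triple \<open>(j, i, s)\<close> stands for the map that multiplies the entry
  \<open>j\<close> by \<open>s\<close>. The type \<open>i\<close> is stored because the scalar zero
  would fit every type.\<close>

definition val :: "nat \<times> 'i \<times> 's \<Rightarrow> 'm list \<Rightarrow> 'm" where
  "val c a = snd (snd c) \<odot>\<^bsub>M\<^esub> (a ! fst c)"

definition ctype :: "nat \<times> 'i \<times> 's \<Rightarrow> 'i" where
  "ctype c = fst (snd c)"

definition inj_coords :: "'m list set \<Rightarrow> (nat \<times> 'i \<times> 's) set \<Rightarrow> bool" where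
  "inj_coords A J \<longleftrightarrow> (\<forall>a\<in>A. \<forall>b\<in>A. (\<forall>c\<in>J. val c a = val c b) \<longrightarrow> a = b)"

definition sur_coords :: "'m list set \<Rightarrow> (nat \<times> 'i \<times> 's) set \<Rightarrow> bool" where
  "sur_coords A J \<longleftrightarrow> (\<forall>f. (\<forall>c\<in>J. f c \<in> V (ctype c)) \<longrightarrow> (\<exists>a\<in>A. \<forall>c\<in>J. val c a = f c))"

text \<open>Surjectivity onto the product of the spaces \<open>V\<close> plays the role of linear
  independence, injectivity that of spanning.\<close>

definition basis :: "nat \<Rightarrow> 'm list set \<Rightarrow> (nat \<times> 'i \<times> 's) set \<Rightarrow> bool" where
  "basis n A J \<longleftrightarrow> finite J \<and> J \<subseteq> coords n \<and> inj_coords A J \<and> sur_coords A J"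

lemma inj_coordsD:
  "inj_coords A J \<Longrightarrow> a \<in> A \<Longrightarrow> b \<in> A \<Longrightarrow> (\<And>c. c \<in> J \<Longrightarrow> val c a = val c b) \<Longrightarrow> a = b"
  unfolding inj_coords_def by blast

lemma sur_coordsD:
  assumes "sur_coords A J" "\<And>c. c \<in> J \<Longrightarrow> f c \<in> V (ctype c)"
  shows "\<exists>a\<in>A. \<forall>c\<in>J. val c a = f c"
  using assms unfolding sur_coords_def by blast

lemma ctype_I: "c \<in> coords n \<Longrightarrow> ctype c \<in> I"
  by (auto simp: coords_def ctype_def)

lemma val_V: "c \<in> coords n \<Longrightarrow> a \<in> mpower M n \<Longrightarrow> val c a \<in> V (ctype c)"
  using act_mult[of "snd (snd c)" "\<epsilon> (ctype c)" "a ! fst c"] nth_mpower[of a n "fst c"]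
  by (auto simp: coords_def val_def ctype_def V_def act_closed eps_closed)

lemma val_shift_list:
  assumes "c \<in> coords n" "h \<in> endo" "x \<in> mpower M n" "y \<in> mpower M n" "z \<in> mpower M n"
  shows "val c (shift_list h x y z) = shift h (val c x) (val c y) (val c z)"
  using assms nth_mpower by (auto simp: coords_def val_def nth_shift_list shift_act)

text \<open>Values prescribed on \<open>K\<close> are extended by zero to \<open>J\<close>; zero is
  an admissible value for every type in \<open>I\<close>.\<close>

lemma sur_coords_mono:
  assumes "sur_coords A J" "J \<subseteq> coords n" "K \<subseteq> J"
  shows "sur_coords A K"
  unfolding sur_coords_def
proof (intro allI impI)
  fix f assume f: "\<forall>c\<in>K. f c \<in> V (ctype c)"
  have "(if c \<in> K then f c else \<zero>\<^bsub>M\<^esub>) \<in> V (ctype c)" if "c \<in> J" for c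
    using f that assms(2) ctype_I[of c n] V_zero by auto
  then obtain a where "a \<in> A" "\<forall>c\<in>J. val c a = (if c \<in> K then f c else \<zero>\<^bsub>M\<^esub>)"
    using sur_coordsD[OF assms(1), of "\<lambda>c. if c \<in> K then f c else \<zero>\<^bsub>M\<^esub>"] by blast
  then show "\<exists>a\<in>A. \<forall>c\<in>K. val c a = f c" using assms(3) by (intro bexI[of _ a]) auto
qed

text \<open>Start from a point \<open>x\<close> with the prescribed values on \<open>J\<close> and
  shift it by \<open>a\<close> and \<open>b\<close>. They agree on \<open>J\<close>, so those values
  stay; they differ at \<open>c\<close>, so any value in the space of \<open>c\<close> can be
  reached there.\<close>

lemma sur_coords_insert:
  assumes A: "A \<subseteq> mpower M n" "shift_closed_set A"
    and J: "J \<subseteq> coords n" "sur_coords A J" and c: "c \<in> coords n"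
    and ab: "a \<in> A" "b \<in> A" "\<forall>j\<in>J. val j a = val j b" "val c a \<noteq> val c b"
  shows "sur_coords A (insert c J)"
  unfolding sur_coords_def
proof (intro allI impI)
  fix f assume f: "\<forall>j\<in>insert c J. f j \<in> V (ctype j)"
  then obtain x where x: "x \<in> A" "\<forall>j\<in>J. val j x = f j"
    using sur_coordsD[OF J(2), of f] by blast
  have m: "a \<in> mpower M n" "b \<in> mpower M n" "x \<in> mpower M n" using ab x A(1) by auto
  obtain h where h: "h \<in> endo" "shift h (val c x) (val c a) (val c b) = f c"
    using shift_reach[OF ctype_I[OF c], of "val c x" "val c a" "val c b" "f c"]
      val_V[OF c] m ab(4) f by blast
  let ?y = "shift_list h x a b"
  have "?y \<in> A" using A(2) h(1) ab x(1) by (auto simp: shift_closed_set_def)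
  moreover have "val j ?y = f j" if "j \<in> insert c J" for j
  proof (cases "j = c")
    case True
    then show ?thesis using h c m by (simp add: val_shift_list)
  next
    case False
    then have j: "j \<in> J" "j \<in> coords n" using that J(1) by auto
    have "val j ?y = shift h (val j x) (val j b) (val j b)"
      using val_shift_list[OF j(2) h(1) m(3,1,2)] ab(3) j(1) by simp
    also have "\<dots> = val j x"
      using val_V[OF j(2)] m V_carrier by (intro shift_same[OF h(1)]) blast+
    finally show ?thesis using x(2) j(1) by simp
  qed
  ultimately show "\<exists>y\<in>A. \<forall>j\<in>insert c J. val j y = f j" by blast
qed

text \<open>A maximal surjective family is injective: a coordinate separating two points that the
  family does not separate could be added to it.\<close>

lemma ex_basis:
  assumes A: "A \<subseteq> mpower M n" "shift_closed_set A" "A \<noteq> {}"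
  obtains J where "basis n A J"
proof -
  \<comment> \<open>A finite supply of coordinates that still determines every point, by
    \<open>us_separate\<close>; finiteness yields a maximal surjective family.\<close>
  define C where "C = {..<n} \<times> us"
  have finC: "finite C" by (simp add: C_def us_finite)
  have CC: "C \<subseteq> coords n" using us_closed by (auto simp: C_def coords_def)
  let ?\<J> = "{J. J \<subseteq> C \<and> sur_coords A J}"
  have "finite ?\<J>" using finC by simp
  \<comment> \<open>Surjectivity of the empty family means just that \<open>A\<close> is
    nonempty.\<close>
  moreover have "{} \<in> ?\<J>" using A(3) by (auto simp: sur_coords_def)
  ultimately obtain J where "J \<in> ?\<J>" and max: "\<forall>K\<in>?\<J>. J \<subseteq> K \<longrightarrow> J = K"
    using finite_has_maximal2[of ?\<J> "{}"] by blast
  then have J: "J \<subseteq> C" "sur_coords A J" by auto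
  have "inj_coords A J"
    unfolding inj_coords_def
  proof (intro ballI impI, rule ccontr)
    fix a b assume ab: "a \<in> A" "b \<in> A" "\<forall>c\<in>J. val c a = val c b" "a \<noteq> b"
    have m: "a \<in> mpower M n" "b \<in> mpower M n" using ab A(1) by auto
    have "\<exists>c\<in>C. val c a \<noteq> val c b"
    proof (rule ccontr)
      assume *: "\<not> (\<exists>c\<in>C. val c a \<noteq> val c b)"
      have "a ! j = b ! j" if "j < n" for j
      proof (rule us_separate)
        show "a ! j \<in> carrier M" "b ! j \<in> carrier M" using m that nth_mpower by auto
        fix i u assume "(i, u) \<in> us"
        then have "(j, i, u) \<in> C" using that by (simp add: C_def)
        then have "val (j, i, u) a = val (j, i, u) b" using * by blast
        then show "u \<odot>\<^bsub>M\<^esub> a ! j = u \<odot>\<^bsub>M\<^esub> b ! j" by (simp add: val_def)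
      qed
      then have "a = b" using m by (intro nth_equalityI) (auto simp: mpower_def)
      then show False using ab(4) by simp
    qed
    then obtain c where c: "c \<in> C" "val c a \<noteq> val c b" by blast
    have "J \<subseteq> coords n" "c \<in> coords n" using J(1) c(1) CC by auto
    then have "sur_coords A (insert c J)"
      using sur_coords_insert[OF A(1,2) _ J(2), of c a b] ab c(2) by blast
    then have "J = insert c J" using max c(1) J(1) by blast
    then show False using c(2) ab(3) by blast
  qed
  then have "basis n A J"
    using J finC CC finite_subset by (auto simp: basis_def)
  then show ?thesis using that by blast
qed

section \<open>Exchange and the number of basis elements of each type\<close>

lemma basis_differ:
  assumes "basis n A J" "j \<in> J" "A \<subseteq> mpower M n"
  obtains a b where "a \<in> A" "b \<in> A" "\<forall>c\<in>J - {j}. val c a = val c b" "val j a \<noteq> val j b"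
proof -
  have J: "J \<subseteq> coords n" "sur_coords A J" using assms by (auto simp: basis_def)
  have z: "\<zero>\<^bsub>M\<^esub> \<in> V (ctype c)" if "c \<in> J" for c using that J(1) ctype_I V_zero by blast
  obtain w where w: "w \<in> V (ctype j)" "w \<noteq> \<zero>\<^bsub>M\<^esub>"
    using V_distinct[of "ctype j" "\<zero>\<^bsub>M\<^esub>"] z[OF assms(2)] assms(2) J(1) ctype_I by blast
  \<comment> \<open>Prescribing zero on all of \<open>J\<close> gives \<open>a\<close>; prescribing
    the nonzero \<open>w\<close> at \<open>j\<close> and zero elsewhere gives
    \<open>b\<close>.\<close>
  obtain a where a: "a \<in> A" "\<forall>c\<in>J. val c a = \<zero>\<^bsub>M\<^esub>" using sur_coordsD[OF J(2), of "\<lambda>_. \<zero>\<^bsub>M\<^esub>"] z by blast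
  have "(if c = j then w else \<zero>\<^bsub>M\<^esub>) \<in> V (ctype c)" if "c \<in> J" for c using z[OF that] w(1) by simp
  then obtain b where b: "b \<in> A" "\<forall>c\<in>J. val c b = (if c = j then w else \<zero>\<^bsub>M\<^esub>)"
    using sur_coordsD[OF J(2), of "\<lambda>c. if c = j then w else \<zero>\<^bsub>M\<^esub>"] by blast
  show ?thesis using a b w(2) assms(2) by (intro that[of a b]) auto
qed

text \<open>A coordinate in \<open>J'\<close> but not in \<open>J\<close> could be varied while all
  the others, including all of \<open>J\<close>, keep their values. This contradicts injectivity of
  \<open>J\<close>.\<close>

lemma basis_subset_eq:
  assumes "basis n A J" "basis n A J'" "J \<subseteq> J'" "A \<subseteq> mpower M n"
  shows "J = J'"
proof (rule ccontr)
  assume "J \<noteq> J'"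
  then obtain c where c: "c \<in> J'" "c \<notin> J" using assms(3) by blast
  obtain a b where ab: "a \<in> A" "b \<in> A" "\<forall>j\<in>J' - {c}. val j a = val j b" "val c a \<noteq> val c b"
    using basis_differ[OF assms(2) c(1) assms(4)] .
  have "a = b"
    using ab assms(1,3) c(2) by (intro inj_coordsD[of A J a b]) (auto simp: basis_def)
  then show False using ab(4) by simp
qed

text \<open>Two points that differ only at \<open>j\<close> among the coordinates in
  \<open>J\<close> are separated by some \<open>j'\<close> in \<open>J'\<close>, and this
  \<open>j'\<close> can replace \<open>j\<close>.\<close>

lemma basis_exchange:
  assumes A: "A \<subseteq> mpower M n" "shift_closed_set A"
    and J: "basis n A J" "basis n A J'" and j: "j \<in> J" "j \<notin> J'"
  obtains j' where "j' \<in> J'" "j' \<notin> J" "ctype j' = ctype j" "basis n A (insert j' (J - {j}))"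
proof -
  have Jb: "finite J" "J \<subseteq> coords n" "inj_coords A J" "sur_coords A J"
    and Jb': "J' \<subseteq> coords n" "inj_coords A J'"
    using J by (auto simp: basis_def)
  obtain a b where ab: "a \<in> A" "b \<in> A" "\<forall>c\<in>J - {j}. val c a = val c b" "val j a \<noteq> val j b"
    using basis_differ[OF J(1) j(1) A(1)] .
  then obtain j' where j': "j' \<in> J'" "val j' a \<noteq> val j' b"
    using inj_coordsD[OF Jb'(2), of a b] by blast
  have j'J: "j' \<notin> J" using j' j(2) ab(3) by blast
  have jc: "j \<in> coords n" "j' \<in> coords n" using j j' Jb Jb' by auto
  have mA: "x \<in> mpower M n" if "x \<in> A" for x using that A(1) by blast
  have shA: "shift_list h x y z \<in> A" if "h \<in> endo" "x \<in> A" "y \<in> A" "z \<in> A" for h x y z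
    using that A(2) by (auto simp: shift_closed_set_def)
  have valM: "val c x \<in> carrier M" if "c \<in> coords n" "x \<in> A" for c x
    using val_V[OF that(1)] V_carrier mA that(2) by blast
  have "ctype j' = ctype j"
  proof (rule ccontr)
    assume ne: "ctype j' \<noteq> ctype j"
    have jI: "ctype j \<in> I" "ctype j' \<in> I" using jc ctype_I by auto
    \<comment> \<open>Shifting \<open>a\<close> by \<open>b\<close> and \<open>a\<close> along the
      central idempotent for the type of \<open>j\<close> turns the value at \<open>j\<close> into
      that of \<open>b\<close> and leaves the rest of \<open>J\<close> alone, so the result is
      \<open>b\<close>. At \<open>j'\<close>, being of another type, the value is still that of
      \<open>a\<close>.\<close>
    define h where "h x = e (ctype j) \<odot>\<^bsub>M\<^esub> x" for x
    have h: "h \<in> endo"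
      unfolding h_def using central_act_endo[OF e_closed[OF jI(1)]] e_central[OF jI(1)] by blast
    define x where "x = shift_list h a b a"
    have xA: "x \<in> A" unfolding x_def using shA h ab by blast
    have vx: "val c x = shift h (val c a) (val c b) (val c a)" if "c \<in> coords n" for c
      unfolding x_def using val_shift_list[OF that h] mA ab(1,2) by blast
    have "x = b"
    proof (rule inj_coordsD[OF Jb(3) xA ab(2)])
      fix c assume c: "c \<in> J"
      then have cc: "c \<in> coords n" using Jb(2) by blast
      show "val c x = val c b"
      proof (cases "c = j")
        case True
        have "h (val j a) = val j a" "h (val j b) = val j b"
          unfolding h_def using act_e_same[OF jI(1)] val_V[OF jc(1)] mA ab by auto
        then show ?thesis using True vx[OF cc] valM[OF cc] ab(1,2)
          by (simp add: shift_def M.minus_eq M.r_neg M.a_lcomm[of "val j a" "val j b"])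
      next
        case False
        then have "val c a = val c b" using ab(3) c by blast
        then show ?thesis using vx[OF cc] valM[OF cc] ab(1,2) shift_same[OF h] by simp
      qed
    qed
    have "h (val j' a) = \<zero>\<^bsub>M\<^esub>" "h (val j' b) = \<zero>\<^bsub>M\<^esub>"
      unfolding h_def using act_e_other[OF jI(2,1) ne] val_V[OF jc(2)] mA ab by auto
    then have "val j' x = val j' a"
      using vx[OF jc(2)] valM[OF jc(2)] ab(1) by (simp add: shift_def M.minus_eq)
    then show False using \<open>x = b\<close> j'(2) by simp
  qed
  moreover have "sur_coords A (insert j' (J - {j}))"
  proof (rule sur_coords_insert[OF A _ _ jc(2) ab(1,2,3) j'(2)])
    show "J - {j} \<subseteq> coords n" using Jb(2) by blast
    show "sur_coords A (J - {j})" using sur_coords_mono[OF Jb(4,2)] by blast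
  qed
  \<comment> \<open>Two points not separated by the new family differ at \<open>j\<close>. Shifting
    \<open>b\<close> by them can give it the value of \<open>a\<close> at \<open>j\<close>, hence
    turn it into \<open>a\<close>, but the value at \<open>j'\<close> remains that of
    \<open>b\<close>.\<close>
  moreover have "inj_coords A (insert j' (J - {j}))"
    unfolding inj_coords_def
  proof (intro ballI impI, rule ccontr)
    fix x y assume xy: "x \<in> A" "y \<in> A" "\<forall>c\<in>insert j' (J - {j}). val c x = val c y" "x \<noteq> y"
    then have ne: "val j x \<noteq> val j y" using inj_coordsD[OF Jb(3) xy(1,2)] by blast
    obtain h where h: "h \<in> endo" "shift h (val j b) (val j x) (val j y) = val j a"
      using shift_reach[OF ctype_I[OF jc(1)], of "val j b" "val j x" "val j y" "val j a"]
        val_V[OF jc(1)] mA ab(1,2) xy(1,2) ne by blast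
    define z where "z = shift_list h b x y"
    have zA: "z \<in> A" unfolding z_def using shA h ab xy by blast
    have vz: "val c z = shift h (val c b) (val c x) (val c y)" if "c \<in> coords n" for c
      unfolding z_def using val_shift_list[OF that h(1)] mA ab(2) xy(1,2) by blast
    have vb: "val c z = val c b" if "c \<in> coords n" "val c x = val c y" for c
      using vz[OF that(1)] that(2) valM[OF that(1)] ab(2) xy(1,2) shift_same[OF h(1)] by simp
    have "z = a"
    proof (rule inj_coordsD[OF Jb(3) zA ab(1)])
      fix c assume c: "c \<in> J"
      then have cc: "c \<in> coords n" using Jb(2) by blast
      show "val c z = val c a"
      proof (cases "c = j")
        case True
        then show ?thesis using vz[OF cc] h(2) by simp
      next
        case False
        then show ?thesis using vb[OF cc] xy(3) c ab(3) by auto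
      qed
    qed
    moreover have "val j' z = val j' b" using vb[OF jc(2)] xy(3) by blast
    ultimately show False using j'(2) by simp
  qed
  ultimately show ?thesis
    using that[OF j'(1) j'J] Jb jc unfolding basis_def by blast
qed

text \<open>Restricted to \<open>I\<close>, so that dimension vectors are elements of the carrier of
  the product monoid.\<close>

definition count_type :: "(nat \<times> 'i \<times> 's) set \<Rightarrow> 'i \<Rightarrow> nat" where
  "count_type J = (\<lambda>i\<in>I. card {c \<in> J. ctype c = i})"

lemma count_type_exchange:
  assumes "finite J" "j \<in> J" "j' \<notin> J" "ctype j' = ctype j"
  shows "count_type (insert j' (J - {j})) = count_type J"
  unfolding count_type_def
proof (rule restrict_ext)
  fix i
  show "card {c \<in> insert j' (J - {j}). ctype c = i} = card {c \<in> J. ctype c = i}"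
  proof (cases "ctype j = i")
    case True
    then have "{c \<in> insert j' (J - {j}). ctype c = i} = insert j' ({c \<in> J. ctype c = i} - {j})"
      using assms(4) by auto
    also have "card \<dots> = Suc (card ({c \<in> J. ctype c = i} - {j}))"
      using assms by (intro card_insert_disjoint) auto
    also have "\<dots> = card {c \<in> J. ctype c = i}"
      using assms True by (intro card_Suc_Diff1) auto
    finally show ?thesis .
  next
    case False
    then have "{c \<in> insert j' (J - {j}). ctype c = i} = {c \<in> J. ctype c = i}"
      using assms(4) by auto
    then show ?thesis by simp
  qed
qed

text \<open>Each exchange removes one element from \<open>J - J'\<close> and preserves the counts.
  Once this difference is empty the bases are nested and therefore equal.\<close>

lemma basis_count_type:
  assumes A: "A \<subseteq> mpower M n" "shift_closed_set A" and J': "basis n A J'"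
  shows "basis n A J \<Longrightarrow> count_type J = count_type J'"
proof (induction "card (J - J')" arbitrary: J rule: less_induct)
  case less
  show ?case
  proof (cases "J \<subseteq> J'")
    case True
    then show ?thesis using basis_subset_eq[OF less.prems J' True A(1)] by simp
  next
    case False
    then obtain j where j: "j \<in> J" "j \<notin> J'" by blast
    obtain j' where j': "j' \<in> J'" "j' \<notin> J" "ctype j' = ctype j"
        "basis n A (insert j' (J - {j}))"
      using basis_exchange[OF A less.prems J' j] .
    have fin: "finite J" using less.prems by (simp add: basis_def)
    have "insert j' (J - {j}) - J' = (J - J') - {j}" using j' by auto
    then have "card (insert j' (J - {j}) - J') < card (J - J')"
      using fin j by (metis DiffI card_Diff1_less finite_Diff)
    then show ?thesis
      using less.hyps j'(4) count_type_exchange[OF fin j(1) j'(2,3)] by simp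
  qed
qed

section \<open>Dimension vectors\<close>

text \<open>The list length is quantified as well, since a nonempty set of lists of equal length
  determines it.\<close>

definition pp_dim :: "'m list set \<Rightarrow> 'i \<Rightarrow> nat" where
  "pp_dim A = (THE d. \<exists>n J. A \<subseteq> mpower M n \<and> basis n A J \<and> d = count_type J)"

lemma pp_sets_iff: "A \<in> pp_sets S M \<longleftrightarrow> A \<noteq> {} \<and> (\<exists>n. pp_definable S M n A)"
  by (simp add: pp_sets_def)

lemma pp_dim_eq:
  assumes "A \<noteq> {}" "A \<subseteq> mpower M n" "shift_closed_set A" "basis n A J"
  shows "pp_dim A = count_type J"
  unfolding pp_dim_def
proof (rule the_equality)
  show "\<exists>n J'. A \<subseteq> mpower M n \<and> basis n A J' \<and> count_type J = count_type J'"
    using assms by blast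
  fix d assume "\<exists>m J'. A \<subseteq> mpower M m \<and> basis m A J' \<and> d = count_type J'"
  then obtain m J' where J': "A \<subseteq> mpower M m" "basis m A J'" "d = count_type J'" by blast
  have "m = n" using assms(1,2) J'(1) by (auto simp: mpower_def)
  then show "d = count_type J"
    using basis_count_type[OF assms(2,3,4)] J'(2,3) by blast
qed

lemma pp_sets_basis:
  assumes "A \<in> pp_sets S M"
  obtains n J where "pp_definable S M n A" "A \<subseteq> mpower M n" "shift_closed_set A" "A \<noteq> {}"
    "basis n A J" "pp_dim A = count_type J"
proof -
  obtain n where n: "A \<noteq> {}" "pp_definable S M n A" using assms by (auto simp: pp_sets_iff)
  have A: "A \<subseteq> mpower M n" "shift_closed_set A"
    using pp_definable_subset[OF n(2)] pp_definable_shift_closed[OF n(2)] by auto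
  obtain J where J: "basis n A J" using ex_basis[OF A n(1)] .
  show ?thesis using that[OF n(2) A n(1) J] pp_dim_eq[OF n(1) A J] by blast
qed

lemma count_type_PiE: "count_type J \<in> (\<Pi>\<^sub>E i\<in>I. UNIV)"
  by (simp add: count_type_def)

section \<open>Dimension of products and of isomorphic sets\<close>

definition shift_coord :: "nat \<Rightarrow> nat \<times> 'i \<times> 's \<Rightarrow> nat \<times> 'i \<times> 's" where
  "shift_coord n c = (n + fst c, snd c)"

lemma ctype_shift_coord [simp]: "ctype (shift_coord n c) = ctype c"
  by (simp add: ctype_def shift_coord_def)

lemma inj_shift_coord: "inj_on (shift_coord n) J"
  by (auto simp: inj_on_def shift_coord_def prod_eq_iff)

lemma shift_coord_coords: "c \<in> coords m \<Longrightarrow> shift_coord n c \<in> coords (n + m)"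
  by (auto simp: coords_def shift_coord_def)

lemma coords_mono: "c \<in> coords n \<Longrightarrow> c \<in> coords (n + m)"
  by (auto simp: coords_def)

lemma val_append1: "c \<in> coords n \<Longrightarrow> xs \<in> mpower M n \<Longrightarrow> val c (xs @ ys) = val c xs"
  by (auto simp: coords_def val_def mpower_def nth_append)

lemma val_append2: "xs \<in> mpower M n \<Longrightarrow> val (shift_coord n c) (xs @ ys) = val c ys"
  by (auto simp: val_def shift_coord_def mpower_def nth_append)

lemma count_type_shift_coord: "count_type (shift_coord n ` J) = count_type J"
  unfolding count_type_def
proof (rule restrict_ext)
  fix i
  have "{c \<in> shift_coord n ` J. ctype c = i} = shift_coord n ` {c \<in> J. ctype c = i}" by auto
  then show "card {c \<in> shift_coord n ` J. ctype c = i} = card {c \<in> J. ctype c = i}"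
    using card_image[OF inj_shift_coord] by metis
qed

lemma count_type_Un:
  assumes "finite J" "finite K" "J \<inter> K = {}"
  shows "count_type (J \<union> K) = (\<lambda>i\<in>I. count_type J i + count_type K i)"
proof -
  have "card {c \<in> J \<union> K. ctype c = i} = card {c \<in> J. ctype c = i} + card {c \<in> K. ctype c = i}" for i
  proof -
    have "{c \<in> J \<union> K. ctype c = i} = {c \<in> J. ctype c = i} \<union> {c \<in> K. ctype c = i}" by auto
    then show ?thesis using assms by (simp add: card_Un_disjoint disjoint_iff)
  qed
  then show ?thesis by (simp add: count_type_def restrict_def fun_eq_iff)
qed

text \<open>Coordinates from \<open>J\<close> see only the first part of a concatenation and shifted
  ones only the second, so injectivity and surjectivity can be checked factor by factor.\<close>

lemma basis_list_times:
  assumes A: "A \<subseteq> mpower M n" "basis n A J" and B: "B \<subseteq> mpower M m" "basis m B K"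
  shows "basis (n + m) (list_times A B) (J \<union> shift_coord n ` K)"
proof -
  have J: "finite J" "J \<subseteq> coords n" "inj_coords A J" "sur_coords A J"
    and K: "finite K" "K \<subseteq> coords m" "inj_coords B K" "sur_coords B K"
    using A B by (auto simp: basis_def)
  have v1: "val c (x @ y) = val c x" if "c \<in> J" "x \<in> A" for c x y
    using that J(2) A(1) by (intro val_append1) auto
  have v2: "val (shift_coord n c) (x @ y) = val c y" if "x \<in> A" for c x y
    using that A(1) by (intro val_append2) auto
  have "inj_coords (list_times A B) (J \<union> shift_coord n ` K)"
    unfolding inj_coords_def
  proof (intro ballI impI)
    fix a b assume "a \<in> list_times A B" "b \<in> list_times A B"
      and eq: "\<forall>c\<in>J \<union> shift_coord n ` K. val c a = val c b"
    then obtain x y x' y' where *: "a = x @ y" "b = x' @ y'" "x \<in> A" "y \<in> B" "x' \<in> A" "y' \<in> B"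
      unfolding list_times_def by blast
    have "val c x = val c x'" if "c \<in> J" for c
      using eq * v1[OF that, of x y] v1[OF that, of x' y'] that by simp
    then have "x = x'" by (rule inj_coordsD[OF J(3) *(3,5)])
    have "val c y = val c y'" if "c \<in> K" for c
      using eq * v2[of x c y] v2[of x' c y'] that by simp
    then have "y = y'" by (rule inj_coordsD[OF K(3) *(4,6)])
    then show "a = b" using * \<open>x = x'\<close> by simp
  qed
  moreover have "sur_coords (list_times A B) (J \<union> shift_coord n ` K)"
    unfolding sur_coords_def
  proof (intro allI impI)
    fix f assume f: "\<forall>c\<in>J \<union> shift_coord n ` K. f c \<in> V (ctype c)"
    obtain x where x: "x \<in> A" "\<forall>c\<in>J. val c x = f c"
      using sur_coordsD[OF J(4), of f] f by blast
    have "f (shift_coord n c) \<in> V (ctype c)" if "c \<in> K" for c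
      using f that ctype_shift_coord[of n c] by (metis UnI2 imageI)
    then obtain y where y: "y \<in> B" "\<forall>c\<in>K. val c y = f (shift_coord n c)"
      using sur_coordsD[OF K(4), of "\<lambda>c. f (shift_coord n c)"] by blast
    have "x @ y \<in> list_times A B" using x y by (auto simp: list_times_def)
    moreover have "\<forall>c\<in>J \<union> shift_coord n ` K. val c (x @ y) = f c" using x y v1 v2 by auto
    ultimately show "\<exists>a\<in>list_times A B. \<forall>c\<in>J \<union> shift_coord n ` K. val c a = f c" by blast
  qed
  moreover have "J \<union> shift_coord n ` K \<subseteq> coords (n + m)"
    using J(2) K(2) coords_mono shift_coord_coords by blast
  ultimately show ?thesis using J(1) K(1) by (simp add: basis_def)
qed

lemma pp_sets_list_times:
  assumes "A \<in> pp_sets S M" "B \<in> pp_sets S M"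
  shows "list_times A B \<in> pp_sets S M"
    and "pp_dim (list_times A B) = (\<lambda>i\<in>I. pp_dim A i + pp_dim B i)"
proof -
  obtain n J where A: "pp_definable S M n A" "A \<subseteq> mpower M n" "shift_closed_set A" "A \<noteq> {}"
      "basis n A J" "pp_dim A = count_type J"
    using pp_sets_basis[OF assms(1)] .
  obtain m K where B: "pp_definable S M m B" "B \<subseteq> mpower M m" "shift_closed_set B" "B \<noteq> {}"
      "basis m B K" "pp_dim B = count_type K"
    using pp_sets_basis[OF assms(2)] .
  have def: "pp_definable S M (n + m) (list_times A B)"
    using pp_definable_list_times A(1) B(1) by blast
  have ne: "list_times A B \<noteq> {}" using A(4) B(4) by (auto simp: list_times_def)
  show "list_times A B \<in> pp_sets S M" using def ne by (auto simp: pp_sets_iff)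
  \<comment> \<open>Coordinates in \<open>J\<close> look at positions below \<open>n\<close>,
    shifted ones at positions from \<open>n\<close> on.\<close>
  have "J \<inter> shift_coord n ` K = {}"
    using A(5) by (auto simp: basis_def coords_def shift_coord_def)
  then have "count_type (J \<union> shift_coord n ` K) = (\<lambda>i\<in>I. count_type J i + count_type K i)"
    using A(5) B(5) by (subst count_type_Un) (auto simp: basis_def count_type_shift_coord)
  then show "pp_dim (list_times A B) = (\<lambda>i\<in>I. pp_dim A i + pp_dim B i)"
    using pp_dim_eq[OF ne pp_definable_subset[OF def] pp_definable_shift_closed[OF def]
        basis_list_times[OF A(2,5) B(2,5)]] A(6) B(6) by simp
qed

text \<open>The graph is definable and projects bijectively to both sides. Hence a basis of
  \<open>A\<close> and a shifted basis of \<open>B\<close> are bases of one set, and their counts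
  agree.\<close>

lemma pp_isomorphism_dim:
  assumes "(A, B) \<in> pp_isomorphism S M"
  shows "pp_dim A = pp_dim B"
proof -
  obtain f l where AB: "A \<in> pp_sets S M" "B \<in> pp_sets S M" and f: "bij_betw f A B"
    and def: "pp_definable S M l {x @ f x | x. x \<in> A}"
    using assms unfolding pp_isomorphism_def by blast
  obtain n J where A: "pp_definable S M n A" "A \<subseteq> mpower M n" "shift_closed_set A" "A \<noteq> {}"
      "basis n A J" "pp_dim A = count_type J"
    using pp_sets_basis[OF AB(1)] .
  obtain m K where B: "pp_definable S M m B" "B \<subseteq> mpower M m" "shift_closed_set B" "B \<noteq> {}"
      "basis m B K" "pp_dim B = count_type K"
    using pp_sets_basis[OF AB(2)] .
  have J: "finite J" "J \<subseteq> coords n" "inj_coords A J" "sur_coords A J"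
    and K: "finite K" "K \<subseteq> coords m" "inj_coords B K" "sur_coords B K"
    using A B by (auto simp: basis_def)
  let ?G = "{x @ f x | x. x \<in> A}"
  have fB: "f x \<in> B" if "x \<in> A" for x using f that bij_betwE by blast
  have G: "?G \<subseteq> mpower M (n + m)" using A(2) B(2) fB mpower_append by blast
  have v1: "val c (x @ y) = val c x" if "c \<in> J" "x \<in> A" for c x y
    using that J(2) A(2) by (intro val_append1) auto
  have v2: "val (shift_coord n c) (x @ y) = val c y" if "x \<in> A" for c x y
    using that A(2) by (intro val_append2) auto
  have "basis (n + m) ?G J"
  proof -
    have "inj_coords ?G J"
      unfolding inj_coords_def
    proof (intro ballI impI)
      fix a b assume "a \<in> ?G" "b \<in> ?G" and eq: "\<forall>c\<in>J. val c a = val c b"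
      then obtain x y where *: "a = x @ f x" "b = y @ f y" "x \<in> A" "y \<in> A" by blast
      have "val c x = val c y" if "c \<in> J" for c
        using eq * v1[OF that, of x "f x"] v1[OF that, of y "f y"] that by simp
      then have "x = y" by (rule inj_coordsD[OF J(3) *(3,4)])
      then show "a = b" using * by simp
    qed
    moreover have "sur_coords ?G J"
      unfolding sur_coords_def
    proof (intro allI impI)
      fix g assume "\<forall>c\<in>J. g c \<in> V (ctype c)"
      then obtain x where x: "x \<in> A" "\<forall>c\<in>J. val c x = g c"
        using sur_coordsD[OF J(4), of g] by blast
      then show "\<exists>a\<in>?G. \<forall>c\<in>J. val c a = g c" using v1 by (intro bexI[of _ "x @ f x"]) auto
    qed
    ultimately show ?thesis using J coords_mono by (auto simp: basis_def)
  qed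
  \<comment> \<open>Here \<open>f\<close> itself enters: its injectivity recovers the first half of
    a pair from the second, and its surjectivity realizes every point of \<open>B\<close>.\<close>
  moreover have "basis (n + m) ?G (shift_coord n ` K)"
  proof -
    have "inj_coords ?G (shift_coord n ` K)"
      unfolding inj_coords_def
    proof (intro ballI impI)
      fix a b assume "a \<in> ?G" "b \<in> ?G" and eq: "\<forall>c\<in>shift_coord n ` K. val c a = val c b"
      then obtain x y where *: "a = x @ f x" "b = y @ f y" "x \<in> A" "y \<in> A" by blast
      have "val c (f x) = val c (f y)" if "c \<in> K" for c
        using eq * v2[of x c "f x"] v2[of y c "f y"] that by simp
      then have "f x = f y" by (rule inj_coordsD[OF K(3) fB[OF *(3)] fB[OF *(4)]])
      then have "x = y" using f * by (auto simp: bij_betw_def inj_on_def)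
      then show "a = b" using * by simp
    qed
    moreover have "sur_coords ?G (shift_coord n ` K)"
      unfolding sur_coords_def
    proof (intro allI impI)
      fix g assume "\<forall>c\<in>shift_coord n ` K. g c \<in> V (ctype c)"
      then have "g (shift_coord n c) \<in> V (ctype c)" if "c \<in> K" for c
        using that ctype_shift_coord[of n c] by (metis imageI)
      then obtain y where y: "y \<in> B" "\<forall>c\<in>K. val c y = g (shift_coord n c)"
        using sur_coordsD[OF K(4), of "\<lambda>c. g (shift_coord n c)"] by blast
      then obtain x where x: "x \<in> A" "y = f x" using f by (auto simp: bij_betw_def)
      then show "\<exists>a\<in>?G. \<forall>c\<in>shift_coord n ` K. val c a = g c"
        using v2 y by (intro bexI[of _ "x @ f x"]) auto
    qed
    moreover have "shift_coord n ` K \<subseteq> coords (n + m)" using K(2) shift_coord_coords by blast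
    ultimately show ?thesis using K(1) by (auto simp: basis_def)
  qed
  ultimately have "count_type J = count_type (shift_coord n ` K)"
    using basis_count_type[OF G pp_definable_shift_closed[OF def]] by blast
  then show ?thesis using A(6) B(6) count_type_shift_coord by simp
qed

section \<open>Isomorphism of sets of equal dimension, and sets of given dimension\<close>

lemma count_type_bij:
  assumes "finite J" "finite K" "J \<subseteq> coords n" "K \<subseteq> coords m" "count_type J = count_type K"
  obtains \<beta> where "bij_betw \<beta> J K" "\<forall>c\<in>J. ctype (\<beta> c) = ctype c"
proof -
  \<comment> \<open>Within each type the two families have the same finite size; the chosen
    bijections are then glued along the type.\<close>
  have "\<forall>i\<in>I. \<exists>g. bij_betw g {c \<in> J. ctype c = i} {c \<in> K. ctype c = i}"
  proof
    fix i assume "i \<in> I"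
    then have "card {c \<in> J. ctype c = i} = card {c \<in> K. ctype c = i}"
      using fun_cong[OF assms(5), of i] by (simp add: count_type_def)
    then show "\<exists>g. bij_betw g {c \<in> J. ctype c = i} {c \<in> K. ctype c = i}"
      using assms(1,2) by (intro finite_same_card_bij) auto
  qed
  then obtain g where g: "\<forall>i\<in>I. bij_betw (g i) {c \<in> J. ctype c = i} {c \<in> K. ctype c = i}"
    by (rule bchoice[THEN exE])
  have JI: "ctype c \<in> I" if "c \<in> J" for c using that assms(3) ctype_I by blast
  have KI: "ctype c \<in> I" if "c \<in> K" for c using that assms(4) ctype_I by blast
  define \<beta> where "\<beta> c = g (ctype c) c" for c
  have \<beta>: "\<beta> c \<in> K \<and> ctype (\<beta> c) = ctype c" if "c \<in> J" for c
    using bspec[OF bij_betwE[OF bspec[OF g JI[OF that]]], of c] that by (simp add: \<beta>_def)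
  have "inj_on \<beta> J"
  proof (rule inj_onI)
    fix c d assume cd: "c \<in> J" "d \<in> J" "\<beta> c = \<beta> d"
    then have "ctype c = ctype d" using \<beta> by metis
    then show "c = d"
      using cd inj_onD[OF bij_betw_imp_inj_on[OF bspec[OF g JI[OF cd(1)]]], of c d]
      by (simp add: \<beta>_def)
  qed
  moreover have "\<beta> ` J = K"
  proof (intro equalityI subsetI)
    fix d assume d: "d \<in> K"
    then have "d \<in> g (ctype d) ` {c \<in> J. ctype c = ctype d}"
      using bij_betw_imp_surj_on[OF bspec[OF g KI[OF d]]] by simp
    then obtain c where "d = g (ctype d) c" "c \<in> {c \<in> J. ctype c = ctype d}" by (rule imageE)
    then show "d \<in> \<beta> ` J" by (intro image_eqI[of _ _ c]) (auto simp: \<beta>_def)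
  qed (use \<beta> in auto)
  ultimately show ?thesis using that \<beta> by (auto simp: bij_betw_def)
qed

definition coord_term :: "nat \<times> 'i \<times> 's \<Rightarrow> 's lterm" where
  "coord_term c = LMult (LVar (fst c)) (snd (snd c))"

lemma lterm_eval_coord_term: "lterm_eval M v (coord_term c) = val c v"
  by (simp add: coord_term_def val_def)

lemma coord_term_wf:
  "c \<in> coords n \<Longrightarrow> lterm_scalars (coord_term c) \<subseteq> carrier S \<and> lterm_vars (coord_term c) \<subseteq> {..<n}"
  by (auto simp: coord_term_def coords_def)

text \<open>A type-preserving matching of bases pairs each point of \<open>A\<close> with the one
  point of \<open>B\<close> that has the same values at the matched coordinates.\<close>

lemma dim_pp_isomorphism:
  assumes AB: "A \<in> pp_sets S M" "B \<in> pp_sets S M" and dim: "pp_dim A = pp_dim B"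
  shows "(A, B) \<in> pp_isomorphism S M"
proof -
  obtain n J where A: "pp_definable S M n A" "A \<subseteq> mpower M n" "shift_closed_set A" "A \<noteq> {}"
      "basis n A J" "pp_dim A = count_type J"
    using pp_sets_basis[OF AB(1)] .
  obtain m K where B: "pp_definable S M m B" "B \<subseteq> mpower M m" "shift_closed_set B" "B \<noteq> {}"
      "basis m B K" "pp_dim B = count_type K"
    using pp_sets_basis[OF AB(2)] .
  have J: "finite J" "J \<subseteq> coords n" "inj_coords A J" "sur_coords A J"
    and K: "finite K" "K \<subseteq> coords m" "inj_coords B K" "sur_coords B K"
    using A B by (auto simp: basis_def)
  obtain \<beta> where \<beta>: "bij_betw \<beta> J K" "\<forall>c\<in>J. ctype (\<beta> c) = ctype c"
    using count_type_bij[OF J(1) K(1) J(2) K(2)] dim A(6) B(6) by metis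
  have \<beta>K: "\<beta> ` J = K" and \<beta>inj: "inj_on \<beta> J" using \<beta>(1) by (auto simp: bij_betw_def)
  define \<gamma> where "\<gamma> = inv_into J \<beta>"
  have \<gamma>: "\<gamma> (\<beta> c) = c" if "c \<in> J" for c using that \<beta>inj by (simp add: \<gamma>_def)
  define rel where "rel x y \<longleftrightarrow> (\<forall>c\<in>J. val c x = val (\<beta> c) y)" for x y
  have "\<forall>x\<in>A. \<exists>y. y \<in> B \<and> rel x y"
  proof
    fix x assume x: "x \<in> A"
    have "val (\<gamma> c) x \<in> V (ctype c)" if c: "c \<in> K" for c
    proof -
      obtain b where "b \<in> J" "c = \<beta> b" using c \<beta>K by blast
      moreover have "val b x \<in> V (ctype b)"
        using \<open>b \<in> J\<close> J(2) A(2) x by (intro val_V[of b n x]) auto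
      ultimately show ?thesis using \<gamma> \<beta>(2) by simp
    qed
    then obtain y where "y \<in> B" "\<forall>c\<in>K. val c y = val (\<gamma> c) x"
      using sur_coordsD[OF K(4), of "\<lambda>c. val (\<gamma> c) x"] by blast
    then show "\<exists>y. y \<in> B \<and> rel x y" using \<beta>K \<gamma> by (intro exI[of _ y]) (auto simp: rel_def)
  qed
  then obtain f where f: "\<forall>x\<in>A. f x \<in> B \<and> rel x (f x)"
    by (rule bchoice[THEN exE])
  \<comment> \<open>Injectivity of \<open>K\<close> makes the partner unique, so the graph of
    \<open>f\<close> is exactly the relation \<open>rel\<close> on \<open>A\<close> and
    \<open>B\<close>.\<close>
  have rel_f: "y = f x" if "x \<in> A" "y \<in> B" "rel x y" for x y
  proof (rule inj_coordsD[OF K(3) that(2)])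
    show "f x \<in> B" using f that by blast
    fix c assume "c \<in> K"
    then obtain b where "b \<in> J" "c = \<beta> b" using \<beta>K by blast
    then show "val c y = val c (f x)" using f that by (auto simp: rel_def)
  qed
  have "bij_betw f A B"
    unfolding bij_betw_def
  proof
    show "inj_on f A"
    proof (rule inj_onI)
      fix x x' assume x: "x \<in> A" "x' \<in> A" "f x = f x'"
      then have "rel x (f x)" "rel x' (f x)" using f by auto
      then show "x = x'" using x by (intro inj_coordsD[OF J(3) x(1,2)]) (auto simp: rel_def)
    qed
    show "f ` A = B"
    proof (intro equalityI subsetI)
      fix y assume y: "y \<in> B"
      have "val (\<beta> c) y \<in> V (ctype c)" if "c \<in> J" for c
        using that \<beta>(2) \<beta>K val_V[of "\<beta> c" m y] K(2) B(2) y by auto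
      then obtain x where x: "x \<in> A" "\<forall>c\<in>J. val c x = val (\<beta> c) y"
        using sur_coordsD[OF J(4), of "\<lambda>c. val (\<beta> c) y"] by blast
      then have "y = f x" using rel_f y by (simp add: rel_def)
      then show "y \<in> f ` A" using x by blast
    qed (use f in auto)
  qed
  moreover have "pp_definable S M (n + m) {x @ f x | x. x \<in> A}"
  proof -
    \<comment> \<open>One linear equation for each pair of matched coordinates; together they cut
      the graph out of the product.\<close>
    define F where "F = (\<lambda>c. (coord_term c, coord_term (shift_coord n (\<beta> c)))) ` J"
    have F: "sat_eqs M (x @ y) F \<longleftrightarrow> rel x y" if "x \<in> A" for x y
    proof -
      have "val c (x @ y) = val c x" if "c \<in> J" for c
        using that J(2) A(2) \<open>x \<in> A\<close> by (intro val_append1) auto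
      moreover have "val (shift_coord n c) (x @ y) = val c y" for c
        using A(2) \<open>x \<in> A\<close> by (intro val_append2) auto
      ultimately show ?thesis
        by (simp add: F_def sat_eqs_def rel_def lterm_eval_coord_term)
    qed
    have "wf_eqs S (n + m) F"
    proof -
      have "c \<in> coords (n + m) \<and> shift_coord n (\<beta> c) \<in> coords (n + m)" if "c \<in> J" for c
        using that J(2) K(2) \<beta>K coords_mono shift_coord_coords by blast
      then show ?thesis using coord_term_wf[of _ "n + m"] unfolding wf_eqs_def F_def by auto
    qed
    then have "pp_definable S M (n + m) {z \<in> list_times A B. sat_eqs M z F}"
      using pp_definable_list_times[OF A(1) B(1)] J(1)
      by (intro pp_definable_solutions) (auto simp: F_def)
    also have "{z \<in> list_times A B. sat_eqs M z F} = {x @ f x | x. x \<in> A}"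
    proof (intro equalityI subsetI)
      fix z assume "z \<in> {z \<in> list_times A B. sat_eqs M z F}"
      then obtain x y where "z = x @ y" "x \<in> A" "y \<in> B" "sat_eqs M (x @ y) F"
        unfolding list_times_def by blast
      then have "z = x @ f x" "x \<in> A" using F[of x y] rel_f[of x y] by auto
      then show "z \<in> {x @ f x | x. x \<in> A}" by blast
    next
      fix z assume "z \<in> {x @ f x | x. x \<in> A}"
      then obtain x where x: "z = x @ f x" "x \<in> A" by blast
      then have "f x \<in> B" "rel x (f x)" using f by auto
      then show "z \<in> {z \<in> list_times A B. sat_eqs M z F}"
        using x F[of x "f x"] unfolding list_times_def by blast
    qed
    finally show ?thesis .
  qed
  ultimately show ?thesis using AB unfolding pp_isomorphism_def by blast
qed

text \<open>The set is a product of spaces \<open>V i\<close>, each taken \<open>d i\<close> times.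
  It is defined in a power of the module by requiring every entry to be fixed by the idempotent of
  its type.\<close>

lemma ex_pp_dim:
  assumes I: "finite I" and d: "d \<in> (\<Pi>\<^sub>E i\<in>I. UNIV)"
  obtains A where "A \<in> pp_sets S M" "pp_dim A = d"
proof -
  \<comment> \<open>\<open>w\<close> lists every index \<open>i\<close> exactly \<open>d i\<close>
    times, in some order; its entry \<open>j\<close> is the type of position
    \<open>j\<close>.\<close>
  obtain w where w: "mset w = (\<Sum>i\<in>I. replicate_mset (d i) i)" using ex_mset by blast
  have cw: "count (mset w) i = (if i \<in> I then d i else 0)" for i
    unfolding w using I by (simp add: count_sum)
  have wI: "i \<in> I" if "i \<in> set w" for i
    using cw[of i] that by (metis count_mset_0_iff)
  define n where "n = length w"
  define cf where "cf j = (j, w ! j, \<epsilon> (w ! j))" for j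
  define J where "J = cf ` {..<n}"
  have wjI: "w ! j \<in> I" if "j < n" for j using that wI by (simp add: n_def)
  have cfc: "cf j \<in> coords n" if "j < n" for j
    using that wjI[OF that] by (simp add: coords_def cf_def eps_closed eps_idem)
  have val_cf: "val (cf j) a = \<epsilon> (w ! j) \<odot>\<^bsub>M\<^esub> (a ! j)" for j a by (simp add: val_def cf_def)
  have ct: "ctype (cf j) = w ! j" for j by (simp add: ctype_def cf_def)
  define F :: "('s lterm \<times> 's lterm) set" where "F = (\<lambda>j. (coord_term (cf j), LVar j)) ` {..<n}"
  define A where "A = {a \<in> mpower M n. sat_eqs M a F}"
  have A: "a \<in> A \<longleftrightarrow> a \<in> mpower M n \<and> (\<forall>j<n. val (cf j) a = a ! j)" for a
    by (auto simp: A_def F_def sat_eqs_def lterm_eval_coord_term)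
  have "wf_eqs S n F"
    using coord_term_wf[OF cfc] unfolding wf_eqs_def F_def by auto
  then have def: "pp_definable S M n A"
    unfolding A_def by (intro pp_definable_solutions pp_definable_mpower) (simp_all add: F_def)
  have "replicate n \<zero>\<^bsub>M\<^esub> \<in> A"
    unfolding A using wjI by (auto simp: mpower_def val_cf eps_closed)
  then have ne: "A \<noteq> {}" by blast
  have "inj_coords A J"
    unfolding inj_coords_def
  proof (intro ballI impI)
    fix a b assume ab: "a \<in> A" "b \<in> A" "\<forall>c\<in>J. val c a = val c b"
    have "a ! j = b ! j" if "j < n" for j using ab that A by (auto simp: J_def)
    then show "a = b" using ab A by (intro nth_equalityI) (auto simp: mpower_def)
  qed
  moreover have "sur_coords A J"
    unfolding sur_coords_def
  proof (intro allI impI)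
    fix f assume f: "\<forall>c\<in>J. f c \<in> V (ctype c)"
    define a where "a = map (\<lambda>j. f (cf j)) [0..<n]"
    have fV: "f (cf j) \<in> V (w ! j)" if "j < n" for j using bspec[OF f, of "cf j"] that ct[of j] by (simp add: J_def)
    have aj: "val (cf j) a = f (cf j)" if "j < n" for j
      using fV[OF that] that by (simp add: val_cf a_def V_def)
    have "a \<in> mpower M n" using V_carrier[OF fV] by (auto simp: a_def mpower_def)
    then have "a \<in> A" using aj by (auto simp: A) (simp add: a_def)
    then show "\<exists>a\<in>A. \<forall>c\<in>J. val c a = f c" using aj by (auto simp: J_def)
  qed
  ultimately have "basis n A J" using cfc by (auto simp: basis_def J_def)
  then have "pp_dim A = count_type J"
    using pp_dim_eq[OF ne pp_definable_subset[OF def] pp_definable_shift_closed[OF def]] by blast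
  also have "count_type J = d"
  proof
    fix i
    show "count_type J i = d i"
    proof (cases "i \<in> I")
      case True
      have "{c \<in> J. ctype c = i} = cf ` {j. j < length w \<and> w ! j = i}"
        using ct by (auto simp: J_def n_def)
      moreover have "inj_on cf {j. j < length w \<and> w ! j = i}" by (simp add: inj_on_def cf_def)
      ultimately have "card {c \<in> J. ctype c = i} = card {j. j < length w \<and> w ! j = i}"
        by (simp add: card_image)
      also have "\<dots> = count (mset w) i"
        by (simp add: count_mset count_list_eq_length_filter length_filter_conv_card eq_commute)
      finally show ?thesis using cw[of i] True by (simp add: count_type_def)
    next
      case False
      then show ?thesis using PiE_arb[OF d False] by (simp add: count_type_def)
    qed
  qed
  finally show ?thesis using that def ne by (auto simp: pp_sets_iff)
qed

section \<open>The monoid of classes\<close>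

text \<open>As equality of dimension vectors the relation is visibly an equivalence, and its classes
  are the fibres of \<open>pp_dim\<close>.\<close>

lemma pp_isomorphism_eq:
  "pp_isomorphism S M = {(A, B). A \<in> pp_sets S M \<and> B \<in> pp_sets S M \<and> pp_dim A = pp_dim B}"
proof -
  have "(A, B) \<in> pp_isomorphism S M \<longleftrightarrow>
      A \<in> pp_sets S M \<and> B \<in> pp_sets S M \<and> pp_dim A = pp_dim B" for A B
    using pp_isomorphism_dim[of A B] dim_pp_isomorphism[of A B]
    by (auto simp: pp_isomorphism_def)
  then show ?thesis by auto
qed

text \<open>As a function of \<open>d\<close>, this will be the isomorphism onto the monoid of
  classes.\<close>

definition dim_class :: "('i \<Rightarrow> nat) \<Rightarrow> 'm list set set" where
  "dim_class d = {A \<in> pp_sets S M. pp_dim A = d}"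

lemma pp_isomorphism_Image:
  "A \<in> pp_sets S M \<Longrightarrow> pp_isomorphism S M `` {A} = dim_class (pp_dim A)"
  by (auto simp: pp_isomorphism_eq dim_class_def)

lemma pp_dim_PiE: "A \<in> pp_sets S M \<Longrightarrow> pp_dim A \<in> (\<Pi>\<^sub>E i\<in>I. UNIV)"
  using pp_sets_basis[of A] count_type_PiE by metis

lemma dim_class_ne:
  assumes "finite I" "d \<in> (\<Pi>\<^sub>E i\<in>I. UNIV)"
  shows "dim_class d \<noteq> {}"
proof -
  obtain A where "A \<in> pp_sets S M" "pp_dim A = d" using ex_pp_dim[OF assms] .
  then show ?thesis by (auto simp: dim_class_def)
qed

lemma pp_class_monoid_carrier:
  assumes "finite I"
  shows "carrier (pp_class_monoid S M) = dim_class ` (\<Pi>\<^sub>E i\<in>I. UNIV)"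
proof -
  have "pp_dim ` pp_sets S M = (\<Pi>\<^sub>E i\<in>I. UNIV)"
    using pp_dim_PiE ex_pp_dim[OF assms] by (auto simp del: PiE_UNIV_domain) (metis imageI)
  moreover have "carrier (pp_class_monoid S M) = (\<lambda>A. dim_class (pp_dim A)) ` pp_sets S M"
    using pp_isomorphism_Image by (auto simp: pp_class_monoid_def quotient_def)
  ultimately show ?thesis by (metis image_image)
qed

text \<open>All representatives give the same class, because dimensions add under products. Both
  classes are nonempty, so the union over representatives is this class and not the empty
  set.\<close>

lemma pp_class_monoid_mult:
  assumes "finite I" "d \<in> (\<Pi>\<^sub>E i\<in>I. UNIV)" "d' \<in> (\<Pi>\<^sub>E i\<in>I. UNIV)"
  shows "dim_class d \<otimes>\<^bsub>pp_class_monoid S M\<^esub> dim_class d' = dim_class (\<lambda>i\<in>I. d i + d' i)"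
proof -
  have "pp_isomorphism S M `` {list_times A B} = dim_class (\<lambda>i\<in>I. d i + d' i)"
    if "A \<in> dim_class d" "B \<in> dim_class d'" for A B
    using that pp_isomorphism_Image[of "list_times A B"] pp_sets_list_times[of A B]
    by (simp add: dim_class_def)
  then show ?thesis
    using dim_class_ne[OF assms(1,2)] dim_class_ne[OF assms(1,3)]
    by (simp add: pp_class_monoid_def)
qed

text \<open>The empty family is a basis of the one-point set.\<close>

lemma pp_class_monoid_one: "\<one>\<^bsub>pp_class_monoid S M\<^esub> = dim_class (\<lambda>i\<in>I. 0)"
proof -
  have def: "pp_definable S M 0 (mpower M 0)" by (rule pp_definable_mpower)
  have m: "mpower M 0 = {[]}" by (auto simp: mpower_def)
  have "basis 0 (mpower M 0) {}"
    by (auto simp: basis_def inj_coords_def sur_coords_def m)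
  then have "pp_dim (mpower M 0) = count_type {}"
    using pp_dim_eq[OF _ pp_definable_subset[OF def] pp_definable_shift_closed[OF def]] m by simp
  moreover have "mpower M 0 \<in> pp_sets S M" using def m by (auto simp: pp_sets_iff)
  ultimately show ?thesis
    using pp_isomorphism_Image by (simp add: pp_class_monoid_def count_type_def)
qed

lemma dim_class_iso:
  assumes "finite I"
  shows "dim_class \<in> iso (product_group I (\<lambda>i. nat_monoid)) (pp_class_monoid S M)"
proof -
  have car: "carrier (product_group I (\<lambda>i. nat_monoid)) = (\<Pi>\<^sub>E i\<in>I. UNIV)"
    by (simp add: nat_monoid_def)
  have "inj_on dim_class (\<Pi>\<^sub>E i\<in>I. UNIV)"
  proof (rule inj_onI)
    fix d d' :: "'i \<Rightarrow> nat"
    assume d: "d \<in> (\<Pi>\<^sub>E i\<in>I. UNIV)" and eq: "dim_class d = dim_class d'"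
    obtain A where "A \<in> dim_class d" using dim_class_ne[OF assms d] by blast
    then show "d = d'" using eq by (auto simp: dim_class_def)
  qed
  then show ?thesis
    using pp_class_monoid_mult[OF assms]
    unfolding iso_def hom_def bij_betw_def car pp_class_monoid_carrier[OF assms]
    by (auto simp: nat_monoid_def)
qed

end

section \<open>Isomorphisms of commutative monoids\<close>

lemma iso_comm_monoid:
  assumes G: "comm_monoid G" and h: "h \<in> iso G H" and one: "h \<one>\<^bsub>G\<^esub> = \<one>\<^bsub>H\<^esub>"
  shows "comm_monoid H"
proof -
  interpret G: comm_monoid G by (rule G)
  \<comment> \<open>Every element of \<open>H\<close> is an image, so each law is pulled back to
    \<open>G\<close>. The unit has its own assumption, since membership in \<open>iso\<close>
    concerns only products.\<close>
  have H: "carrier H = h ` carrier G"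
    and mult: "\<And>x y. x \<in> carrier G \<Longrightarrow> y \<in> carrier G \<Longrightarrow> h x \<otimes>\<^bsub>H\<^esub> h y = h (x \<otimes>\<^bsub>G\<^esub> y)"
    using h by (auto simp: iso_def hom_def bij_betw_def)
  show ?thesis
    by (rule comm_monoidI)
      (auto simp: H mult G.m_assoc one[symmetric] G.m_ac)
qed

text \<open>Closure of \<open>G\<close> puts the product of two preimages back into the domain,
  where the inverse map undoes \<open>h\<close>.\<close>

lemma iso_inverse:
  assumes h: "h \<in> iso G H"
    and closed: "\<And>x y. x \<in> carrier G \<Longrightarrow> y \<in> carrier G \<Longrightarrow> x \<otimes>\<^bsub>G\<^esub> y \<in> carrier G"
  shows "H \<cong> G"
proof (rule is_isoI)
  let ?g = "inv_into (carrier G) h"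
  have b: "bij_betw h (carrier G) (carrier H)" using h by (simp add: iso_def)
  have "?g (x \<otimes>\<^bsub>H\<^esub> y) = ?g x \<otimes>\<^bsub>G\<^esub> ?g y" if "x \<in> carrier H" "y \<in> carrier H" for x y
  proof -
    have g: "?g x \<in> carrier G" "?g y \<in> carrier G" "h (?g x) = x" "h (?g y) = y"
      using b that by (auto simp: bij_betw_inv_into_right intro!: bij_betwE[OF bij_betw_inv_into[OF b], rule_format])
    have "x \<otimes>\<^bsub>H\<^esub> y = h (?g x \<otimes>\<^bsub>G\<^esub> ?g y)" using h g by (simp add: iso_def hom_def)
    then show ?thesis using bij_betw_inv_into_left[OF b closed[OF g(1,2)]] by simp
  qed
  then show "?g \<in> iso H G"
    using bij_betw_inv_into[OF b] bij_betwE[OF bij_betw_inv_into[OF b]]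
    by (auto simp: iso_def hom_def)
qed

lemma comm_monoid_nat_power: "comm_monoid (product_group I (\<lambda>i. nat_monoid))"
  by (rule comm_monoidI) (auto simp: nat_monoid_def fun_eq_iff PiE_iff extensional_def restrict_def)

text \<open>Scaling each component by a positive number is injective and additive, and its image
  consists of the multiples.\<close>

lemma nat_power_iso_multiples:
  assumes "\<And>i. i \<in> I \<Longrightarrow> q i \<ge> 1"
  shows "(\<lambda>d. \<lambda>i\<in>I. q i * d i)
    \<in> iso (product_group I (\<lambda>i. nat_monoid)) (product_group I (\<lambda>i. multiples_monoid (q i)))"
proof -
  let ?h = "\<lambda>d. \<lambda>i\<in>I. q i * d i"
  have "inj_on ?h (\<Pi>\<^sub>E i\<in>I. UNIV)"
  proof (rule inj_onI)
    fix d d' :: "_ \<Rightarrow> nat"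
    assume *: "d \<in> (\<Pi>\<^sub>E i\<in>I. UNIV)" "d' \<in> (\<Pi>\<^sub>E i\<in>I. UNIV)" "?h d = ?h d'"
    show "d = d'"
    proof (rule PiE_ext[OF *(1,2)])
      fix i assume i: "i \<in> I"
      then have "q i * d i = q i * d' i" using fun_cong[OF *(3), of i] by simp
      then show "d i = d' i" using assms[OF i] by simp
    qed
  qed
  moreover have "?h ` (\<Pi>\<^sub>E i\<in>I. UNIV) = (\<Pi>\<^sub>E i\<in>I. range (\<lambda>n. q i * n))"
  proof (intro equalityI subsetI)
    fix x assume x: "x \<in> (\<Pi>\<^sub>E i\<in>I. range (\<lambda>n. q i * n))"
    \<comment> \<open>The preimage is obtained by division, which is exact because
      \<open>x i\<close> is a multiple of \<open>q i\<close>.\<close>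
    have "x = ?h (\<lambda>i\<in>I. x i div q i)"
    proof (rule PiE_ext[OF x])
      show "?h (\<lambda>i\<in>I. x i div q i) \<in> (\<Pi>\<^sub>E i\<in>I. range (\<lambda>n. q i * n))" by auto
      fix i assume i: "i \<in> I"
      then have "q i dvd x i" using x by (auto simp: PiE_iff)
      then show "x i = ?h (\<lambda>i\<in>I. x i div q i) i" using i by simp
    qed
    then show "x \<in> ?h ` (\<Pi>\<^sub>E i\<in>I. UNIV)"
      by (rule image_eqI[where x = "\<lambda>i\<in>I. x i div q i"]) simp
  qed auto
  ultimately show ?thesis
    by (auto simp: iso_def hom_def bij_betw_def nat_monoid_def multiples_monoid_def
        fun_eq_iff add_mult_distrib2)
qed

section \<open>Matrix blocks\<close>

text \<open>A matrix unit scaled by \<open>r\<close>.\<close>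

definition single :: "nat \<Rightarrow> ('r, 'c) ring_scheme \<Rightarrow> nat \<Rightarrow> nat \<Rightarrow> 'r \<Rightarrow> nat \<times> nat \<Rightarrow> 'r" where
  "single q R a b r = (\<lambda>(i, j)\<in>{..<q} \<times> {..<q}. if i = a \<and> j = b then r else \<zero>\<^bsub>R\<^esub>)"

context ring
begin

lemma single_closed: "r \<in> carrier R \<Longrightarrow> single q R a b r \<in> carrier (matrix_ring q R)"
  by (auto simp: single_def matrix_ring_def)

lemma matrix_nth_closed:
  "A \<in> carrier (matrix_ring q R) \<Longrightarrow> i < q \<Longrightarrow> j < q \<Longrightarrow> A (i, j) \<in> carrier R"
  by (auto simp: matrix_ring_def PiE_iff)

text \<open>Only the summand with \<open>l = a\<close> can be nonzero: column \<open>a\<close> is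
  scaled by \<open>r\<close> from the right and moved to column \<open>b\<close>.\<close>

lemma matrix_mult_single:
  assumes A: "A \<in> carrier (matrix_ring q R)" and a: "a < q" and r: "r \<in> carrier R"
  shows "A \<otimes>\<^bsub>matrix_ring q R\<^esub> single q R a b r =
    (\<lambda>(i, j)\<in>{..<q} \<times> {..<q}. if j = b then A (i, a) \<otimes> r else \<zero>)"
proof -
  have "(\<Oplus>l\<in>{..<q}. A (i, l) \<otimes> single q R a b r (l, j)) = (if j = b then A (i, a) \<otimes> r else \<zero>)"
    if ij: "i < q" "j < q" for i j
  proof -
    have "(\<Oplus>l\<in>{..<q}. A (i, l) \<otimes> single q R a b r (l, j)) =
        (\<Oplus>l\<in>{..<q}. if a = l then if j = b then A (i, l) \<otimes> r else \<zero> else \<zero>)"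
      using matrix_nth_closed[OF A ij(1)] ij r
      by (intro finsum_cong') (auto simp: single_def)
    also have "\<dots> = (if j = b then A (i, a) \<otimes> r else \<zero>)"
      using matrix_nth_closed[OF A ij(1)] a r by (intro finsum_singleton) auto
    finally show ?thesis .
  qed
  then show ?thesis by (auto simp: matrix_ring_def)
qed

lemma single_mult_matrix:
  assumes A: "A \<in> carrier (matrix_ring q R)" and b: "b < q" and r: "r \<in> carrier R"
  shows "single q R a b r \<otimes>\<^bsub>matrix_ring q R\<^esub> A =
    (\<lambda>(i, j)\<in>{..<q} \<times> {..<q}. if i = a then r \<otimes> A (b, j) else \<zero>)"
proof -
  have "(\<Oplus>l\<in>{..<q}. single q R a b r (i, l) \<otimes> A (l, j)) = (if i = a then r \<otimes> A (b, j) else \<zero>)"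
    if ij: "i < q" "j < q" for i j
  proof -
    have "(\<Oplus>l\<in>{..<q}. single q R a b r (i, l) \<otimes> A (l, j)) =
        (\<Oplus>l\<in>{..<q}. if b = l then if i = a then r \<otimes> A (l, j) else \<zero> else \<zero>)"
      using matrix_nth_closed[OF A _ ij(2)] ij r
      by (intro finsum_cong') (auto simp: single_def)
    also have "\<dots> = (if i = a then r \<otimes> A (b, j) else \<zero>)"
      using matrix_nth_closed[OF A _ ij(2)] b r by (intro finsum_singleton) auto
    finally show ?thesis .
  qed
  then show ?thesis by (auto simp: matrix_ring_def)
qed

lemma single_mult_single:
  assumes "a < q" "b < q" "r \<in> carrier R" "s \<in> carrier R"
  shows "single q R c a r \<otimes>\<^bsub>matrix_ring q R\<^esub> single q R a b s = single q R c b (r \<otimes> s)"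
  using assms matrix_mult_single[OF single_closed[OF assms(3), of q c a] assms(1,4), of b]
  by (auto simp: single_def fun_eq_iff)

end

text \<open>The data for one block, pulled back from matrices: \<open>\<epsilon>\<close> comes from
  the matrix unit at (0, 0), and \<open>us\<close> from the matrix units in column 0. Minimality
  holds because a nonzero row over a division ring has an invertible entry.\<close>

lemma matrix_block:
  assumes S: "ring S" and e: "central_idempotent S e" and R: "skew_field R" and q: "q \<ge> 1"
    and iso: "ideal_ring S e \<simeq> matrix_ring q R"
  shows "\<exists>\<epsilon> us. \<epsilon> \<in> carrier S \<and> \<epsilon> \<otimes>\<^bsub>S\<^esub> \<epsilon> = \<epsilon> \<and> \<epsilon> \<otimes>\<^bsub>S\<^esub> e = \<epsilon> \<and>
    (\<forall>s\<in>carrier S. \<epsilon> \<otimes>\<^bsub>S\<^esub> s \<noteq> \<zero>\<^bsub>S\<^esub> \<longrightarrow> (\<exists>t\<in>carrier S. (\<epsilon> \<otimes>\<^bsub>S\<^esub> s) \<otimes>\<^bsub>S\<^esub> t = \<epsilon>)) \<and>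
    finite us \<and> us \<subseteq> carrier S \<and> (\<forall>u\<in>us. u \<otimes>\<^bsub>S\<^esub> \<epsilon> = u) \<and>
    (\<forall>K. \<zero>\<^bsub>S\<^esub> \<in> K \<longrightarrow> (\<forall>s\<in>K. \<forall>t\<in>K. s \<oplus>\<^bsub>S\<^esub> t \<in> K) \<longrightarrow>
      (\<forall>s\<in>K. \<forall>t\<in>carrier S. s \<otimes>\<^bsub>S\<^esub> t \<in> K) \<longrightarrow> us \<subseteq> K \<longrightarrow> e \<in> K)"
proof -
  interpret S: ring S by (rule S)
  interpret R: skew_field R by (rule R)
  let ?T = "ideal_ring S e" and ?Q = "matrix_ring q R"
  have eS: "e \<in> carrier S" and ee: "e \<otimes>\<^bsub>S\<^esub> e = e"
    and ec: "\<And>s. s \<in> carrier S \<Longrightarrow> s \<otimes>\<^bsub>S\<^esub> e = e \<otimes>\<^bsub>S\<^esub> s"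
    using e by (auto simp: central_idempotent_def)
  have T: "x \<in> carrier ?T \<longleftrightarrow> x \<in> carrier S \<and> x \<otimes>\<^bsub>S\<^esub> e = x" for x
    using eS ee by (auto simp: ideal_ring_def S.m_assoc image_iff) metis
  have Tmult: "x \<otimes>\<^bsub>S\<^esub> y \<in> carrier ?T" if "x \<in> carrier ?T" "y \<in> carrier ?T" for x y
    using that eS by (auto simp: T S.m_assoc)
  have Tadd: "x \<oplus>\<^bsub>S\<^esub> y \<in> carrier ?T" if "x \<in> carrier ?T" "y \<in> carrier ?T" for x y
    using that eS by (auto simp: T S.l_distr)
  obtain \<phi> where \<phi>: "\<phi> \<in> ring_iso ?T ?Q" using iso by (auto simp: is_ring_iso_def)
  have bij: "bij_betw \<phi> (carrier ?T) (carrier ?Q)" and \<phi>1: "\<phi> e = \<one>\<^bsub>?Q\<^esub>"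
    and \<phi>mult: "\<And>x y. x \<in> carrier ?T \<Longrightarrow> y \<in> carrier ?T \<Longrightarrow> \<phi> (x \<otimes>\<^bsub>S\<^esub> y) = \<phi> x \<otimes>\<^bsub>?Q\<^esub> \<phi> y"
    and \<phi>add: "\<And>x y. x \<in> carrier ?T \<Longrightarrow> y \<in> carrier ?T \<Longrightarrow> \<phi> (x \<oplus>\<^bsub>S\<^esub> y) = \<phi> x \<oplus>\<^bsub>?Q\<^esub> \<phi> y"
    using \<phi> by (auto simp: ring_iso_def ring_hom_def ideal_ring_def)
  have \<phi>c: "\<phi> x \<in> carrier ?Q" if "x \<in> carrier ?T" for x using bij that bij_betwE by blast
  define \<psi> where "\<psi> = inv_into (carrier ?T) \<phi>"
  have \<psi>T: "\<psi> A \<in> carrier ?T" and \<phi>\<psi>: "\<phi> (\<psi> A) = A" if "A \<in> carrier ?Q" for A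
    using that bij_betwE[OF bij_betw_inv_into[OF bij]] bij_betw_inv_into_right[OF bij]
    by (auto simp: \<psi>_def)
  have \<psi>\<phi>: "\<psi> (\<phi> x) = x" if "x \<in> carrier ?T" for x
    using that bij_betw_inv_into_left[OF bij] by (simp add: \<psi>_def)
  have \<psi>S: "\<psi> A \<in> carrier S" and \<psi>e: "\<psi> A \<otimes>\<^bsub>S\<^esub> e = \<psi> A" if "A \<in> carrier ?Q" for A
    using \<psi>T[OF that] T by auto
  have \<psi>mult: "\<psi> (A \<otimes>\<^bsub>?Q\<^esub> B) = \<psi> A \<otimes>\<^bsub>S\<^esub> \<psi> B" if "A \<in> carrier ?Q" "B \<in> carrier ?Q" for A B
    using that \<phi>mult[OF \<psi>T \<psi>T, of A B] \<psi>\<phi>[OF Tmult[OF \<psi>T \<psi>T], of A B] by (simp add: \<phi>\<psi>)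
  have \<psi>add: "\<psi> (A \<oplus>\<^bsub>?Q\<^esub> B) = \<psi> A \<oplus>\<^bsub>S\<^esub> \<psi> B" if "A \<in> carrier ?Q" "B \<in> carrier ?Q" for A B
    using that \<phi>add[OF \<psi>T \<psi>T, of A B] \<psi>\<phi>[OF Tadd[OF \<psi>T \<psi>T], of A B] by (simp add: \<phi>\<psi>)
  have zQ: "\<zero>\<^bsub>?Q\<^esub> \<in> carrier ?Q" and zz: "\<zero>\<^bsub>?Q\<^esub> \<oplus>\<^bsub>?Q\<^esub> \<zero>\<^bsub>?Q\<^esub> = \<zero>\<^bsub>?Q\<^esub>"
    by (auto simp: matrix_ring_def)
  \<comment> \<open>Additivity and cancellation are used, since a ring isomorphism is not defined to
    preserve zero.\<close>
  have \<psi>0: "\<psi> \<zero>\<^bsub>?Q\<^esub> = \<zero>\<^bsub>S\<^esub>"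
    using \<psi>add[OF zQ zQ] \<psi>S[OF zQ] unfolding zz by (metis S.add.l_cancel_one')
  have \<psi>1: "\<psi> \<one>\<^bsub>?Q\<^esub> = e" using \<psi>\<phi>[of e] \<phi>1 eS ee T by simp
  let ?E = "\<lambda>a b. single q R a b \<one>\<^bsub>R\<^esub>"
  have E: "?E a b \<in> carrier ?Q" for a b using R.single_closed by simp
  have EE: "?E c a \<otimes>\<^bsub>?Q\<^esub> ?E a b = ?E c b" if "a < q" "b < q" for a b c
    using R.single_mult_single[OF that] by simp
  define \<epsilon> where "\<epsilon> = \<psi> (?E 0 0)"
  define us where "us = (\<lambda>p. \<psi> (?E p 0)) ` {..<q}"
  have eps: "\<epsilon> \<in> carrier S" "\<epsilon> \<otimes>\<^bsub>S\<^esub> e = \<epsilon>" unfolding \<epsilon>_def using \<psi>S \<psi>e E by auto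
  have "\<epsilon> \<otimes>\<^bsub>S\<^esub> \<epsilon> = \<epsilon>"
    unfolding \<epsilon>_def using \<psi>mult[OF E E, of 0 0 0 0] EE[of 0 0 0] q by simp
  moreover have "\<exists>t\<in>carrier S. (\<epsilon> \<otimes>\<^bsub>S\<^esub> s) \<otimes>\<^bsub>S\<^esub> t = \<epsilon>"
    if s: "s \<in> carrier S" and ne: "\<epsilon> \<otimes>\<^bsub>S\<^esub> s \<noteq> \<zero>\<^bsub>S\<^esub>" for s
  proof -
    have seT: "s \<otimes>\<^bsub>S\<^esub> e \<in> carrier ?T" using s eS ee by (simp add: T S.m_assoc)
    define A where "A = \<phi> (s \<otimes>\<^bsub>S\<^esub> e)"
    have A: "A \<in> carrier ?Q" using \<phi>c seT A_def by simp
    have EA: "?E 0 0 \<otimes>\<^bsub>?Q\<^esub> A =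
        (\<lambda>(i, j)\<in>{..<q} \<times> {..<q}. if i = 0 then A (0, j) else \<zero>\<^bsub>R\<^esub>)"
      using R.single_mult_matrix[OF A, of 0 "\<one>\<^bsub>R\<^esub>" 0] q R.matrix_nth_closed[OF A]
      by (auto simp: fun_eq_iff restrict_def)
    have EAc: "?E 0 0 \<otimes>\<^bsub>?Q\<^esub> A \<in> carrier ?Q"
      unfolding EA using R.matrix_nth_closed[OF A] q by (auto simp: matrix_ring_def)
    \<comment> \<open>As \<open>\<epsilon>\<close> absorbs the central \<open>e\<close>, the scalar
      \<open>s\<close> can be replaced by its component in the block.\<close>
    have "\<epsilon> \<otimes>\<^bsub>S\<^esub> s = \<epsilon> \<otimes>\<^bsub>S\<^esub> (s \<otimes>\<^bsub>S\<^esub> e)"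
      using eps s eS ec[OF s] by (metis S.m_assoc)
    also have "\<dots> = \<psi> (?E 0 0 \<otimes>\<^bsub>?Q\<^esub> A)"
      unfolding \<epsilon>_def using \<psi>mult[OF E A] \<psi>\<phi>[OF seT] by (simp add: A_def)
    finally have es: "\<epsilon> \<otimes>\<^bsub>S\<^esub> s = \<psi> (?E 0 0 \<otimes>\<^bsub>?Q\<^esub> A)" .
    have "\<exists>j<q. A (0, j) \<noteq> \<zero>\<^bsub>R\<^esub>"
    proof (rule ccontr)
      assume "\<not> (\<exists>j<q. A (0, j) \<noteq> \<zero>\<^bsub>R\<^esub>)"
      then have "?E 0 0 \<otimes>\<^bsub>?Q\<^esub> A = \<zero>\<^bsub>?Q\<^esub>"
        unfolding EA by (auto simp: matrix_ring_def fun_eq_iff restrict_def)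
      then show False using es \<psi>0 ne by simp
    qed
    then obtain j where j: "j < q" "A (0, j) \<noteq> \<zero>\<^bsub>R\<^esub>" by blast
    then have "A (0, j) \<in> Units R" using R.matrix_nth_closed[OF A, of 0 j] R.units q by auto
    then have r: "inv\<^bsub>R\<^esub> A (0, j) \<in> carrier R" "A (0, j) \<otimes>\<^bsub>R\<^esub> inv\<^bsub>R\<^esub> A (0, j) = \<one>\<^bsub>R\<^esub>" by auto
    \<comment> \<open>Multiplication by this matrix moves column \<open>j\<close> to column 0 and
      normalizes the chosen entry to one; row 0 is the only row that is left by then.\<close>
    let ?B = "single q R j 0 (inv\<^bsub>R\<^esub> A (0, j))"
    have "(?E 0 0 \<otimes>\<^bsub>?Q\<^esub> A) \<otimes>\<^bsub>?Q\<^esub> ?B = ?E 0 0"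
      using R.matrix_mult_single[OF EAc j(1) r(1), of 0] r j(1) q
      unfolding EA by (auto simp: single_def fun_eq_iff restrict_def)
    then have "(\<epsilon> \<otimes>\<^bsub>S\<^esub> s) \<otimes>\<^bsub>S\<^esub> \<psi> ?B = \<epsilon>"
      using \<psi>mult[OF EAc R.single_closed[OF r(1)]] es \<epsilon>_def by metis
    then show ?thesis using \<psi>S[OF R.single_closed[OF r(1)]] by blast
  qed
  moreover have "us \<subseteq> carrier S" "\<forall>u\<in>us. u \<otimes>\<^bsub>S\<^esub> \<epsilon> = u" "finite us"
    unfolding us_def \<epsilon>_def using \<psi>S E \<psi>mult[OF E E, symmetric] EE q by auto
  moreover have "e \<in> K"
    if K: "\<zero>\<^bsub>S\<^esub> \<in> K" "\<forall>s\<in>K. \<forall>t\<in>K. s \<oplus>\<^bsub>S\<^esub> t \<in> K" "\<forall>s\<in>K. \<forall>t\<in>carrier S. s \<otimes>\<^bsub>S\<^esub> t \<in> K" "us \<subseteq> K" for K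
  proof -
    \<comment> \<open>\<open>D r\<close> is the partial identity with the first \<open>r\<close>
      diagonal entries. Each further diagonal unit is a product of one from column 0 and one from
      row 0, and the first factor already corresponds to an element of \<open>K\<close>.\<close>
    define D where "D r = (\<lambda>(i, j)\<in>{..<q} \<times> {..<q}. if i = j \<and> i < r then \<one>\<^bsub>R\<^esub> else \<zero>\<^bsub>R\<^esub>)" for r
    have D: "D r \<in> carrier ?Q" for r by (auto simp: D_def matrix_ring_def)
    have "r \<le> q \<Longrightarrow> \<psi> (D r) \<in> K" for r
    proof (induction r)
      case 0
      have "D 0 = \<zero>\<^bsub>?Q\<^esub>" by (auto simp: D_def matrix_ring_def fun_eq_iff restrict_def)
      then show ?case using K(1) \<psi>0 by simp
    next
      case (Suc r)
      have "D (Suc r) = D r \<oplus>\<^bsub>?Q\<^esub> ?E r r"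
        by (auto simp: D_def matrix_ring_def single_def fun_eq_iff restrict_def)
      also have "?E r r = ?E r 0 \<otimes>\<^bsub>?Q\<^esub> ?E 0 r" using EE[of 0 r r] Suc.prems by simp
      finally have "D (Suc r) = D r \<oplus>\<^bsub>?Q\<^esub> (?E r 0 \<otimes>\<^bsub>?Q\<^esub> ?E 0 r)" .
      moreover have "?E r 0 \<otimes>\<^bsub>?Q\<^esub> ?E 0 r \<in> carrier ?Q" using EE[of 0 r r] Suc.prems E by simp
      ultimately have "\<psi> (D (Suc r)) = \<psi> (D r) \<oplus>\<^bsub>S\<^esub> (\<psi> (?E r 0) \<otimes>\<^bsub>S\<^esub> \<psi> (?E 0 r))"
        using \<psi>add[OF D] \<psi>mult[OF E E] by simp
      moreover have "\<psi> (?E r 0) \<in> K" using K(4) Suc.prems by (auto simp: us_def)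
      ultimately show ?case using K(2,3) Suc \<psi>S[OF E] by simp
    qed
    moreover have "D q = \<one>\<^bsub>?Q\<^esub>" by (auto simp: D_def matrix_ring_def fun_eq_iff restrict_def)
    ultimately show ?thesis using \<psi>1 by (metis order_refl)
  qed
  ultimately show ?thesis using eps by (intro exI[of _ \<epsilon>] exI[of _ us]) blast
qed

section \<open>Central idempotents of a product of rings\<close>

lemma product_idempotents_orthogonal:
  assumes S: "ring S" and e: "\<And>i. i \<in> I \<Longrightarrow> central_idempotent S (e i)"
    and iso: "(\<lambda>s. \<lambda>i\<in>I. s \<otimes>\<^bsub>S\<^esub> e i) \<in> ring_iso S (product_ring I (\<lambda>i. ideal_ring S (e i)))"
    and ij: "i \<in> I" "j \<in> I" "i \<noteq> j"
  shows "e i \<otimes>\<^bsub>S\<^esub> e j = \<zero>\<^bsub>S\<^esub>"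
proof -
  interpret S: ring S by (rule S)
  have ec: "e l \<in> carrier S" "e l \<otimes>\<^bsub>S\<^esub> e l = e l" if "l \<in> I" for l
    using e[OF that] by (auto simp: central_idempotent_def)
  \<comment> \<open>The tuple with \<open>e i\<close> in place \<open>i\<close> and zero elsewhere
    comes from some \<open>s\<close>, so \<open>s\<close> fixes \<open>e i\<close> and annihilates
    \<open>e j\<close>. Multiplying the product of \<open>e i\<close> and \<open>e j\<close> by
    \<open>s\<close> therefore leaves it unchanged and also, by centrality, gives zero.\<close>
  define x where "x = (\<lambda>l\<in>I. if l = i then e i else \<zero>\<^bsub>S\<^esub>)"
  have "e i \<in> (\<lambda>s. s \<otimes>\<^bsub>S\<^esub> e i) ` carrier S" using ec ij(1) by (intro image_eqI[of _ _ "e i"]) auto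
  moreover have "\<zero>\<^bsub>S\<^esub> \<in> (\<lambda>s. s \<otimes>\<^bsub>S\<^esub> e l) ` carrier S" if "l \<in> I" for l
    using ec that by (intro image_eqI[of _ _ "\<zero>\<^bsub>S\<^esub>"]) auto
  ultimately have "x \<in> carrier (product_ring I (\<lambda>i. ideal_ring S (e i)))"
    by (auto simp: x_def product_ring_def ideal_ring_def)
  then obtain s where s: "s \<in> carrier S" "x = (\<lambda>i\<in>I. s \<otimes>\<^bsub>S\<^esub> e i)"
    using iso unfolding ring_iso_def bij_betw_def by blast
  have "s \<otimes>\<^bsub>S\<^esub> e i = e i" "s \<otimes>\<^bsub>S\<^esub> e j = \<zero>\<^bsub>S\<^esub>"
    using fun_cong[OF s(2), of i] fun_cong[OF s(2), of j] ij by (auto simp: x_def)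
  moreover have "e i \<otimes>\<^bsub>S\<^esub> e j = e j \<otimes>\<^bsub>S\<^esub> e i"
    using e[OF ij(2)] ec(1)[OF ij(1)] by (simp add: central_idempotent_def)
  ultimately have "e i \<otimes>\<^bsub>S\<^esub> e j = (s \<otimes>\<^bsub>S\<^esub> e j) \<otimes>\<^bsub>S\<^esub> e i"
    using ec(1)[OF ij(1)] ec(1)[OF ij(2)] s(1) by (metis S.m_assoc)
  then show ?thesis using \<open>s \<otimes>\<^bsub>S\<^esub> e j = \<zero>\<^bsub>S\<^esub>\<close> ec(1)[OF ij(1)] by simp
qed

text \<open>The sum of all \<open>e i\<close> lies in \<open>K\<close> and has the same components
  as the identity, so it is the identity by injectivity of the decomposition.\<close>

lemma product_idempotents_generate:
  fixes k :: nat
  assumes S: "ring S" and e: "\<And>i. i \<in> {1..k} \<Longrightarrow> central_idempotent S (e i)"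
    and iso: "(\<lambda>s. \<lambda>i\<in>{1..k}. s \<otimes>\<^bsub>S\<^esub> e i)
      \<in> ring_iso S (product_ring {1..k} (\<lambda>i. ideal_ring S (e i)))"
    and K: "\<zero>\<^bsub>S\<^esub> \<in> K" "\<And>s t. s \<in> K \<Longrightarrow> t \<in> K \<Longrightarrow> s \<oplus>\<^bsub>S\<^esub> t \<in> K" "\<And>i. i \<in> {1..k} \<Longrightarrow> e i \<in> K"
  shows "\<one>\<^bsub>S\<^esub> \<in> K"
proof -
  interpret S: ring S by (rule S)
  have ec: "e i \<in> carrier S" "e i \<otimes>\<^bsub>S\<^esub> e i = e i" if "i \<in> {1..k}" for i
    using e[OF that] by (auto simp: central_idempotent_def)
  \<comment> \<open>The witness \<open>f\<close> is the sum of the first \<open>r\<close>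
    idempotents, described by its components to avoid a formal sum.\<close>
  have partial: "r \<le> k \<Longrightarrow> \<exists>f\<in>carrier S. f \<in> K \<and>
      (\<forall>j\<in>{1..k}. f \<otimes>\<^bsub>S\<^esub> e j = (if j \<le> r then e j else \<zero>\<^bsub>S\<^esub>))" for r
  proof (induction r)
    case 0
    then show ?case using K(1) ec by (intro bexI[of _ "\<zero>\<^bsub>S\<^esub>"]) auto
  next
    case (Suc r)
    then obtain f where f: "f \<in> carrier S" "f \<in> K"
        "\<forall>j\<in>{1..k}. f \<otimes>\<^bsub>S\<^esub> e j = (if j \<le> r then e j else \<zero>\<^bsub>S\<^esub>)"
      by auto
    have r: "Suc r \<in> {1..k}" using Suc.prems by simp
    have "(f \<oplus>\<^bsub>S\<^esub> e (Suc r)) \<otimes>\<^bsub>S\<^esub> e j = (if j \<le> Suc r then e j else \<zero>\<^bsub>S\<^esub>)" if j: "j \<in> {1..k}" for j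
    proof (cases "j = Suc r")
      case True
      then show ?thesis using f ec(1)[OF r] ec(2)[OF r] r by (simp add: S.l_distr)
    next
      case False
      then have "e (Suc r) \<otimes>\<^bsub>S\<^esub> e j = \<zero>\<^bsub>S\<^esub>"
        using product_idempotents_orthogonal[OF S e iso r j] by simp
      then show ?thesis using f(1,3) ec(1)[OF r] ec(1)[OF j] j False by (simp add: S.l_distr)
    qed
    then show ?case
      using f(1,2) K(2) K(3)[OF r] ec(1)[OF r] by (intro bexI[of _ "f \<oplus>\<^bsub>S\<^esub> e (Suc r)"]) auto
  qed
  obtain f where f: "f \<in> carrier S" "f \<in> K" "\<forall>j\<in>{1..k}. f \<otimes>\<^bsub>S\<^esub> e j = e j"
    using partial[of k] by auto
  have "inj_on (\<lambda>s. \<lambda>i\<in>{1..k}. s \<otimes>\<^bsub>S\<^esub> e i) (carrier S)"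
    using iso by (simp add: ring_iso_def bij_betw_def)
  moreover have "(\<lambda>i\<in>{1..k}. f \<otimes>\<^bsub>S\<^esub> e i) = (\<lambda>i\<in>{1..k}. \<one>\<^bsub>S\<^esub> \<otimes>\<^bsub>S\<^esub> e i)"
    using f(3) ec(1) by (intro restrict_ext) simp
  ultimately have "f = \<one>\<^bsub>S\<^esub>" using f(1) by (auto dest: inj_onD)
  then show ?thesis using f(2) by simp
qed

theorem theorem6p3:
  fixes S :: "('s, 'a) ring_scheme"
    and M :: "('s, 'm, 'b) module_scheme"
    and R :: "nat \<Rightarrow> ('r, 'c) ring_scheme"
    and e :: "nat \<Rightarrow> 's"
    and q :: "nat \<Rightarrow> nat"
    and k :: nat
  assumes "ring S"
    and "\<And>i. i \<in> {1..k} \<Longrightarrow> central_idempotent S (e i)"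
    and "(\<lambda>s. \<lambda>i\<in>{1..k}. s \<otimes>\<^bsub>S\<^esub> e i)
           \<in> ring_iso S (product_ring {1..k} (\<lambda>i. ideal_ring S (e i)))"
    and "\<And>i. i \<in> {1..k} \<Longrightarrow> skew_field (R i)"
    and "\<And>i. i \<in> {1..k} \<Longrightarrow> q i \<ge> 1"
    and "\<And>i. i \<in> {1..k} \<Longrightarrow> ideal_ring S (e i) \<simeq> matrix_ring (q i) (R i)"
    and "right_module S M"
    and "\<And>i. i \<in> {1..k} \<Longrightarrow> infinite ((\<lambda>x. e i \<odot>\<^bsub>M\<^esub> x) ` carrier M)"
  shows "comm_monoid (pp_class_monoid S M)
       \<and> pp_class_monoid S M \<cong> product_group {1..k} (\<lambda>i. multiples_monoid (q i))
       \<and> product_group {1..k} (\<lambda>i. multiples_monoid (q i)) \<cong> product_group {1..k} (\<lambda>i. nat_monoid)"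
proof -
  let ?I = "{1..k}"
  interpret S: ring S by (rule assms(1))
  interpret M: right_module S M by (rule assms(7))
  have ec: "e i \<in> carrier S" "\<And>s. s \<in> carrier S \<Longrightarrow> s \<otimes>\<^bsub>S\<^esub> e i = e i \<otimes>\<^bsub>S\<^esub> s" if "i \<in> ?I" for i
    using assms(2)[OF that] by (auto simp: central_idempotent_def)
  define block where "block i \<epsilon> us \<longleftrightarrow> \<epsilon> \<in> carrier S \<and> \<epsilon> \<otimes>\<^bsub>S\<^esub> \<epsilon> = \<epsilon> \<and> \<epsilon> \<otimes>\<^bsub>S\<^esub> e i = \<epsilon> \<and>
    (\<forall>s\<in>carrier S. \<epsilon> \<otimes>\<^bsub>S\<^esub> s \<noteq> \<zero>\<^bsub>S\<^esub> \<longrightarrow> (\<exists>t\<in>carrier S. (\<epsilon> \<otimes>\<^bsub>S\<^esub> s) \<otimes>\<^bsub>S\<^esub> t = \<epsilon>)) \<and>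
    finite us \<and> us \<subseteq> carrier S \<and> (\<forall>u\<in>us. u \<otimes>\<^bsub>S\<^esub> \<epsilon> = u) \<and>
    (\<forall>K. \<zero>\<^bsub>S\<^esub> \<in> K \<longrightarrow> (\<forall>s\<in>K. \<forall>t\<in>K. s \<oplus>\<^bsub>S\<^esub> t \<in> K) \<longrightarrow>
      (\<forall>s\<in>K. \<forall>t\<in>carrier S. s \<otimes>\<^bsub>S\<^esub> t \<in> K) \<longrightarrow> us \<subseteq> K \<longrightarrow> e i \<in> K)" for i \<epsilon> us
  have "\<forall>i\<in>?I. \<exists>p. block i (fst p) (snd p)"
  proof
    fix i assume i: "i \<in> ?I"
    show "\<exists>p. block i (fst p) (snd p)"
      using matrix_block[OF assms(1) assms(2)[OF i] assms(4)[OF i] assms(5)[OF i] assms(6)[OF i]]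
      unfolding block_def by simp
  qed
  then obtain p where p: "\<forall>i\<in>?I. block i (fst (p i)) (snd (p i))"
    by (rule bchoice[THEN exE])
  define \<epsilon> where "\<epsilon> i = fst (p i)" for i
  define U where "U i = snd (p i)" for i
  have b: "block i (\<epsilon> i) (U i)" if "i \<in> ?I" for i using p that by (simp add: \<epsilon>_def U_def)
  have eps: "\<epsilon> i \<in> carrier S" "\<epsilon> i \<otimes>\<^bsub>S\<^esub> \<epsilon> i = \<epsilon> i" "\<epsilon> i \<otimes>\<^bsub>S\<^esub> e i = \<epsilon> i"
      "\<And>s. s \<in> carrier S \<Longrightarrow> \<epsilon> i \<otimes>\<^bsub>S\<^esub> s \<noteq> \<zero>\<^bsub>S\<^esub> \<Longrightarrow> \<exists>t\<in>carrier S. (\<epsilon> i \<otimes>\<^bsub>S\<^esub> s) \<otimes>\<^bsub>S\<^esub> t = \<epsilon> i"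
      "finite (U i)" "U i \<subseteq> carrier S" "\<And>u. u \<in> U i \<Longrightarrow> u \<otimes>\<^bsub>S\<^esub> \<epsilon> i = u"
    if "i \<in> ?I" for i
    using b[OF that] unfolding block_def by auto
  have gen: "e i \<in> K" if "i \<in> ?I" "\<zero>\<^bsub>S\<^esub> \<in> K" "\<forall>s\<in>K. \<forall>t\<in>K. s \<oplus>\<^bsub>S\<^esub> t \<in> K"
    "\<forall>s\<in>K. \<forall>t\<in>carrier S. s \<otimes>\<^bsub>S\<^esub> t \<in> K" "U i \<subseteq> K" for i K
    using b[OF that(1)] that(2-) unfolding block_def by blast
  \<comment> \<open>The generators of the blocks are collected into one finite set, each tagged with
    the index of its block.\<close>
  interpret B: block_module S M ?I e \<epsilon> "Sigma ?I U"
  proof unfold_locales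
    fix i j assume ij: "i \<in> ?I" "j \<in> ?I" "i \<noteq> j"
    \<comment> \<open>Inserting \<open>e i\<close>, which \<open>\<epsilon> i\<close> absorbs,
      reduces the claim to the orthogonality of \<open>e i\<close> and \<open>e j\<close>.\<close>
    have "\<epsilon> i \<otimes>\<^bsub>S\<^esub> e j = \<epsilon> i \<otimes>\<^bsub>S\<^esub> (e i \<otimes>\<^bsub>S\<^esub> e j)"
      using eps(1,3)[OF ij(1)] ec(1)[OF ij(1)] ec(1)[OF ij(2)] by (metis S.m_assoc)
    then show "\<epsilon> i \<otimes>\<^bsub>S\<^esub> e j = \<zero>\<^bsub>S\<^esub>"
      using product_idempotents_orthogonal[OF assms(1,2,3) ij] eps(1)[OF ij(1)] by simp
  next
    fix K assume K: "K \<subseteq> carrier S" "\<zero>\<^bsub>S\<^esub> \<in> K" "\<And>s t. s \<in> K \<Longrightarrow> t \<in> K \<Longrightarrow> s \<oplus>\<^bsub>S\<^esub> t \<in> K"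
      "\<And>s t. s \<in> K \<Longrightarrow> t \<in> carrier S \<Longrightarrow> s \<otimes>\<^bsub>S\<^esub> t \<in> K" "snd ` Sigma ?I U \<subseteq> K"
    show "\<one>\<^bsub>S\<^esub> \<in> K"
    proof (rule product_idempotents_generate[OF assms(1,2,3) K(2,3)])
      fix i assume i: "i \<in> ?I"
      have "U i \<subseteq> K" using K(5) i by force
      then show "e i \<in> K" using gen[OF i K(2)] K(3,4) by blast
    qed
  next
    fix i u assume "(i, u) \<in> Sigma ?I U"
    then have "i \<in> ?I" "u \<in> U i" by auto
    then show "i \<in> ?I \<and> u \<in> carrier S \<and> u \<otimes>\<^bsub>S\<^esub> \<epsilon> i = u"
      using eps(6,7)[of i] by blast
  next
    fix i assume i: "i \<in> ?I"
    \<comment> \<open>Otherwise the image of \<open>e i\<close> would be contained in the zero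
      submodule, whereas it is infinite.\<close>
    have "\<exists>x\<in>carrier M. e i \<odot>\<^bsub>M\<^esub> x \<noteq> \<zero>\<^bsub>M\<^esub>"
    proof (rule ccontr)
      assume "\<not> (\<exists>x\<in>carrier M. e i \<odot>\<^bsub>M\<^esub> x \<noteq> \<zero>\<^bsub>M\<^esub>)"
      then have "(\<lambda>x. e i \<odot>\<^bsub>M\<^esub> x) ` carrier M \<subseteq> {\<zero>\<^bsub>M\<^esub>}" by auto
      then show False using assms(8)[OF i] finite_subset by blast
    qed
    then obtain x where x: "x \<in> carrier M" "e i \<odot>\<^bsub>M\<^esub> x \<noteq> \<zero>\<^bsub>M\<^esub>" by blast
    \<comment> \<open>The annihilator of \<open>x\<close> is a right ideal; if it contained
      \<open>U i\<close>, it would contain \<open>e i\<close>.\<close>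
    have "\<exists>u\<in>U i. u \<odot>\<^bsub>M\<^esub> x \<noteq> \<zero>\<^bsub>M\<^esub>"
    proof (rule ccontr)
      assume "\<not> (\<exists>u\<in>U i. u \<odot>\<^bsub>M\<^esub> x \<noteq> \<zero>\<^bsub>M\<^esub>)"
      then have "U i \<subseteq> {s \<in> carrier S. s \<odot>\<^bsub>M\<^esub> x = \<zero>\<^bsub>M\<^esub>}" using eps(6)[OF i] by auto
      then have "e i \<in> {s \<in> carrier S. s \<odot>\<^bsub>M\<^esub> x = \<zero>\<^bsub>M\<^esub>}"
        using x(1) by (intro gen[OF i]) (auto simp: M.add_act M.act_mult)
      then show False using x(2) by simp
    qed
    then obtain u where u: "u \<in> U i" "u \<odot>\<^bsub>M\<^esub> x \<noteq> \<zero>\<^bsub>M\<^esub>" by blast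
    have uS: "u \<in> carrier S" using u(1) eps(6)[OF i] by blast
    then have "\<epsilon> i \<odot>\<^bsub>M\<^esub> (u \<odot>\<^bsub>M\<^esub> x) = u \<odot>\<^bsub>M\<^esub> x"
      using M.act_mult[OF uS eps(1)[OF i] x(1)] eps(7)[OF i u(1)] by simp
    then show "\<exists>v\<in>carrier M. v \<noteq> \<zero>\<^bsub>M\<^esub> \<and> \<epsilon> i \<odot>\<^bsub>M\<^esub> v = v"
      using u(2) M.act_closed[OF uS x(1)] by blast
  qed (use ec eps in \<open>auto simp del: atLeastAtMost_iff\<close>)
  \<comment> \<open>Both isomorphisms start from the power of the natural numbers: its elements
    index the classes by dimension, and scaling takes them to tuples of multiples.\<close>
  let ?N = "product_group ?I (\<lambda>i. nat_monoid)"
  interpret N: comm_monoid ?N by (rule comm_monoid_nat_power)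
  have cls: "B.dim_class \<in> iso ?N (pp_class_monoid S M)" by (rule B.dim_class_iso) simp
  have scale: "(\<lambda>d. \<lambda>i\<in>?I. q i * d i) \<in> iso ?N (product_group ?I (\<lambda>i. multiples_monoid (q i)))"
    by (rule nat_power_iso_multiples) (rule assms(5))
  have "comm_monoid (pp_class_monoid S M)"
    using iso_comm_monoid[OF N.comm_monoid_axioms cls] B.pp_class_monoid_one
    by (simp add: nat_monoid_def)
  moreover have "pp_class_monoid S M \<cong> ?N" using cls N.m_closed by (rule iso_inverse)
  moreover have "?N \<cong> product_group ?I (\<lambda>i. multiples_monoid (q i))"
    using scale by (rule is_isoI)
  moreover have "product_group ?I (\<lambda>i. multiples_monoid (q i)) \<cong> ?N"
    using scale N.m_closed by (rule iso_inverse)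
  ultimately show ?thesis using iso_trans by blast
qed

end
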